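(* Let $\Phi=\{f_i(x)=A_ix+t_i\}_{i\in\mathcal{A}}$ be a dominated planar IFS of affinities with affinity dimension $s_0\in(1,2]$. Let $X$ be the attractor of $\Phi$, let $X_F\subset\mathbb{RP}^1$ be the set of Furstenberg directions, let $\mu_K$ be the Käenmäki measure and let $\pi\colon\Sigma\to X$ be the natural projection. Furthermore, suppose that $\Phi$ satisfies the open bounded neighbourhood condition. Then the following are equivalent: (1) $\mathcal{H}^{s_0}(X)>0$; (2) there exists a constant $C>0$ such that $(\mathrm{proj}_V)_*\pi_*\mu_K(B(t,r))\leq C\cdot r$ for every $V\in X_F$, $t\in \mathrm{proj}_V(X)$ and $r>0$.
   Context: Planar IFS of affinities: $\mathcal{A}$ is a finite index set and $f_i(x)=A_ix+t_i$ on $\mathbb{R}^2$ with $A_i$ a real $2\times2$ matrix, $\|A_i\|<1$, $\det A_i\neq0$, $t_i\in\mathbb{R}^2$. The attractor $X$ is the unique non-empty compact set with $X=\bigcup_{i\in\mathcal{A}}f_i(X)$. Words: $\Sigma=\mathcal{A}^{\mathbb{N}}$ (product topology), $\Sigma_*=\bigcup_{n\ge0}\mathcal{A}^n$; $|\mathbf{i}|$ is the length of $\mathbf{i}$; $\mathbf{i}|_n$ is the prefix of length $n$; $\mathbf{i}_-$ is the word $\mathbf{i}\in\Sigma_*$ with its last symbol removed; $[\mathbf{i}]\subset\Sigma$ is the cylinder of infinite words with prefix $\mathbf{i}\in\Sigma_*$; the left shift is $\sigma$. For $\mathbf{i}=(i_1,\dots,i_n)$: $f_{\mathbf{i}}=f_{i_1}\circ\cdots\circ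 f_{i_n}$, $A_{\mathbf{i}}=A_{i_1}\cdots A_{i_n}$ (identity for the empty word), and $A^*_{\mathbf{i}}:=A_{i_1}^*\cdots A_{i_n}^*$ (product of transposes in this order). The natural projection is $\pi(\mathbf{i})=\lim_{n}f_{\mathbf{i}|_n}(0)$. Affinity dimension: with $\alpha_1(A)\ge\alpha_2(A)$ the singular values, $\varphi^s(A)=\alpha_1(A)^s$ for $0\le s\le1$, $\varphi^s(A)=\alpha_1(A)\alpha_2(A)^{s-1}$ for $1< s\le2$, $\varphi^s(A)=|\det A|^{s/2}$ for $s>2$; $s_0=\inf\{s>0:\sum_{n\ge1}\sum_{\mathbf{i}\in\mathcal{A}^n}\varphi^s(A_{\mathbf{i}})<\infty\}$. Dominated: there are $C>0$, $0<\tau<1$ with $\alpha_2(A_{\mathbf{i}})\le C\tau^{|\mathbf{i}|}\alpha_1(A_{\mathbf{i}})$ for all $\mathbf{i}\in\Sigma_*$. Equivalently (Bochi–Gourmelon), there is a strongly invariant multicone: a non-empty proper subset $\mathcal{C}\subset\mathbb{RP}^1$ that is a finite union of closed projective intervals, with $\bigcup_{i}A_i^*\mathcal{C}\subseteq\mathcal{C}^o$ (interior). Fix such $\mathcal{C}$; the Furstenberg directions are $X_F=\bigcap_{n\ge0}\bigcup_{|\mathbf{i}|=n}A^*_{\mathbf{i}}\mathcal{C}$. Käenmäki measure: under domination, $\mu_K$ is the unique left-shift invariant ergodic Borel probability measure on $\Sigma$ for which there is $c>0$ with $c^{-1}\varphi^{s_0}(A_{\mathbf{i}})\le\mu_K([\mathbf{i}])\le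 c\,\varphi^{s_0}(A_{\mathbf{i}})$ for all $\mathbf{i}\in\Sigma_*$. Open bounded neighbourhood condition (OBNC): for $r>0$ let $\Delta_r=\{\mathbf{i}\in\Sigma_*:\alpha_2(A_{\mathbf{i}})|X|\le r<\alpha_2(A_{\mathbf{i}_-})|X|\}$, where $|X|$ is the diameter of $X$ (only words of length at least $1$ are considered). $\Phi$ satisfies the OBNC if there exist a non-empty open bounded set $U\subset\mathbb{R}^2$ with $f_i(U)\subseteq U$ for every $i\in\mathcal{A}$ and a constant $C>0$ such that $\#\{\mathbf{i}\in\Delta_r:f_{\mathbf{i}}(U)\cap B(x,r)\neq\emptyset\}\le C$ for every $r>0$ and $x\in\mathbb{R}^2$. $\mathcal{H}^s$ is Hausdorff measure, normalized as $\lim_{\delta\to0}\mathcal{H}^s_\delta$ with $\mathcal{H}^s_\delta(A)=\inf\{\sum_i|U_i|^s:A\subseteq\bigcup_iU_i,\ |U_i|<\delta\}$ ($|U|$ = diameter). For $V\in\mathbb{RP}^1$ (a line through the origin), $\mathrm{proj}_V\colon\mathbb{R}^2\to V$ is orthogonal projection; $B(x,r)$ is the ball of radius $r$ centred at $x$ (in $\mathbb{R}^2$, or in $V$ for points of $V$). *)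

theory Defs
  imports "HOL-Probability.Probability"
begin

text \<open>
  An affine system \<open>f\<^sub>i(x) = A\<^sub>i x + t\<^sub>i\<close> on the plane is given by two families \<open>A\<close>, \<open>t\<close> indexed
  by a finite type \<open>'a\<close>; finite words are lists, infinite words are functions \<open>nat \<Rightarrow> 'a\<close>.
\<close>

section \<open>Planar affine systems\<close>

definition affine_ifs :: "('a::finite \<Rightarrow> real^2^2) \<Rightarrow> ('a \<Rightarrow> real^2) \<Rightarrow> bool" where
  "affine_ifs A t \<longleftrightarrow> (\<forall>i. onorm ((*v) (A i)) < 1 \<and> det (A i) \<noteq> 0)"

definition aff :: "('a \<Rightarrow> real^2^2) \<Rightarrow> ('a \<Rightarrow> real^2) \<Rightarrow> 'a \<Rightarrow> real^2 \<Rightarrow> real^2" where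
  "aff A t i x = A i *v x + t i"

definition aff_word :: "('a \<Rightarrow> real^2^2) \<Rightarrow> ('a \<Rightarrow> real^2) \<Rightarrow> 'a list \<Rightarrow> real^2 \<Rightarrow> real^2" where
  "aff_word A t w = foldr (\<lambda>i g. aff A t i \<circ> g) w id"

definition mat_word :: "('a \<Rightarrow> real^2^2) \<Rightarrow> 'a list \<Rightarrow> real^2^2" where
  "mat_word A w = foldr (\<lambda>i M. A i ** M) w (mat 1)"

text \<open>The transposes are multiplied in the order of the word, so this is not the transpose
  of \<open>mat_word A w\<close>.\<close>

definition adj_word :: "('a \<Rightarrow> real^2^2) \<Rightarrow> 'a list \<Rightarrow> real^2^2" where
  "adj_word A w = mat_word (\<lambda>i. transpose (A i)) w"

definition is_attractor ::
    "('a::finite \<Rightarrow> real^2^2) \<Rightarrow> ('a \<Rightarrow> real^2) \<Rightarrow> (real^2) set \<Rightarrow> bool" where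
  "is_attractor A t X \<longleftrightarrow> X \<noteq> {} \<and> compact X \<and> X = (\<Union>i. aff A t i ` X)"

definition word_prefix :: "nat \<Rightarrow> (nat \<Rightarrow> 'a) \<Rightarrow> 'a list" where
  "word_prefix n x = map x [0..<n]"

definition natural_proj ::
    "('a \<Rightarrow> real^2^2) \<Rightarrow> ('a \<Rightarrow> real^2) \<Rightarrow> (nat \<Rightarrow> 'a) \<Rightarrow> real^2" where
  "natural_proj A t x = lim (\<lambda>n. aff_word A t (word_prefix n x) 0)"

section \<open>Singular values and the affinity dimension\<close>

definition eigenvals :: "real^2^2 \<Rightarrow> real set" where
  "eigenvals M = {l. \<exists>v. v \<noteq> 0 \<and> M *v v = l *\<^sub>R v}"

text \<open>In dimension two the eigenvalues of the symmetric matrix \<open>A\<^sup>T A\<close>, counted with multiplicity,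
  are the maximum and the minimum of its (one- or two-element) set of eigenvalues.\<close>

definition alpha1 :: "real^2^2 \<Rightarrow> real" where
  "alpha1 M = sqrt (Max (eigenvals (transpose M ** M)))"

definition alpha2 :: "real^2^2 \<Rightarrow> real" where
  "alpha2 M = sqrt (Min (eigenvals (transpose M ** M)))"

definition sv_fun :: "real \<Rightarrow> real^2^2 \<Rightarrow> real" where
  "sv_fun s M =
     (if s \<le> 1 then alpha1 M powr s
      else if s \<le> 2 then alpha1 M * alpha2 M powr (s - 1)
      else \<bar>det M\<bar> powr (s / 2))"

definition affinity_dim :: "('a::finite \<Rightarrow> real^2^2) \<Rightarrow> real" where
  "affinity_dim A =
     Inf {s. 0 < s \<and> summable (\<lambda>n. \<Sum>w | length w = Suc n. sv_fun s (mat_word A w))}"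

section \<open>Domination and Furstenberg directions\<close>

definition dominated :: "('a::finite \<Rightarrow> real^2^2) \<Rightarrow> bool" where
  "dominated A \<longleftrightarrow>
     (\<exists>C>0. \<exists>\<tau>. 0 < \<tau> \<and> \<tau> < 1 \<and>
        (\<forall>w. alpha2 (mat_word A w) \<le> C * \<tau> ^ length w * alpha1 (mat_word A w)))"

definition rp1 :: "(real^2) set set" where
  "rp1 = {V. subspace V \<and> dim V = 1}"

text \<open>The quotient topology of the map \<open>v \<mapsto> span {v}\<close> on the punctured plane.\<close>

definition rp1_topology :: "(real^2) set topology" where
  "rp1_topology = topology (\<lambda>S. S \<subseteq> rp1 \<and> open {v. v \<noteq> 0 \<and> span {v} \<in> S})"

lemma openin_rp1_topology:
  "openin rp1_topology S \<longleftrightarrow> S \<subseteq> rp1 \<and> open {v. v \<noteq> 0 \<and> span {v} \<in> S}"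
proof -
  have "istopology (\<lambda>S. S \<subseteq> rp1 \<and> open {v::real^2. v \<noteq> 0 \<and> span {v} \<in> S})"
    unfolding istopology_def
  proof (intro conjI allI impI)
    fix S T :: "(real^2) set set"
    assume S: "S \<subseteq> rp1 \<and> open {v. v \<noteq> 0 \<and> span {v} \<in> S}"
      and T: "T \<subseteq> rp1 \<and> open {v. v \<noteq> 0 \<and> span {v} \<in> T}"
    have "{v. v \<noteq> 0 \<and> span {v} \<in> S \<inter> T} =
        {v. v \<noteq> 0 \<and> span {v} \<in> S} \<inter> {v. v \<noteq> 0 \<and> span {v} \<in> T}"
      by auto
    with S T show "open {v. v \<noteq> 0 \<and> span {v} \<in> S \<inter> T}"
      by (simp add: open_Int)
    from S show "S \<inter> T \<subseteq> rp1" by auto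
  next
    fix \<K> :: "(real^2) set set set"
    assume K: "\<forall>K\<in>\<K>. K \<subseteq> rp1 \<and> open {v. v \<noteq> 0 \<and> span {v} \<in> K}"
    have "{v. v \<noteq> 0 \<and> span {v} \<in> \<Union>\<K>} = (\<Union>K\<in>\<K>. {v. v \<noteq> 0 \<and> span {v} \<in> K})"
      by auto
    with K show "open {v. v \<noteq> 0 \<and> span {v} \<in> \<Union>\<K>}"
      by (simp add: open_UN)
    from K show "\<Union>\<K> \<subseteq> rp1" by auto
  qed
  then show ?thesis
    unfolding rp1_topology_def by (simp add: topology_inverse')
qed

definition line_at :: "real \<Rightarrow> (real^2) set" where
  "line_at \<theta> = span {vector [cos \<theta>, sin \<theta>]}"

definition proj_interval :: "(real^2) set set \<Rightarrow> bool" where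
  "proj_interval I \<longleftrightarrow> (\<exists>a b. a \<le> b \<and> I = line_at ` {a..b})"

definition rp1_act :: "real^2^2 \<Rightarrow> (real^2) set \<Rightarrow> (real^2) set" where
  "rp1_act M V = (*v) M ` V"

definition strongly_invariant_multicone ::
    "('a::finite \<Rightarrow> real^2^2) \<Rightarrow> (real^2) set set \<Rightarrow> bool" where
  "strongly_invariant_multicone A \<C> \<longleftrightarrow>
     \<C> \<noteq> {} \<and> \<C> \<subset> rp1 \<and>
     (\<exists>\<I>. finite \<I> \<and> (\<forall>I\<in>\<I>. proj_interval I) \<and> \<C> = \<Union>\<I>) \<and>
     (\<Union>i. rp1_act (transpose (A i)) ` \<C>) \<subseteq> rp1_topology interior_of \<C>"

definition furstenberg_dirs ::
    "('a::finite \<Rightarrow> real^2^2) \<Rightarrow> (real^2) set set \<Rightarrow> (real^2) set set" where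
  "furstenberg_dirs A \<C> = (\<Inter>n. \<Union>w\<in>{w. length w = n}. rp1_act (adj_word A w) ` \<C>)"

section \<open>The Kaenmaki measure\<close>

definition word_borel :: "(nat \<Rightarrow> 'a::finite) measure" where
  "word_borel =
     sigma UNIV {S. openin (product_topology (\<lambda>_. discrete_topology UNIV) UNIV) S}"

definition shift :: "(nat \<Rightarrow> 'a) \<Rightarrow> nat \<Rightarrow> 'a" where
  "shift x = (\<lambda>n. x (Suc n))"

definition cylinder :: "'a list \<Rightarrow> (nat \<Rightarrow> 'a) set" where
  "cylinder w = {x. word_prefix (length w) x = w}"

definition shift_invariant :: "(nat \<Rightarrow> 'a) measure \<Rightarrow> bool" where
  "shift_invariant \<mu> \<longleftrightarrow> (\<forall>B\<in>sets \<mu>. emeasure \<mu> (shift -` B) = emeasure \<mu> B)"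

definition shift_ergodic :: "(nat \<Rightarrow> 'a) measure \<Rightarrow> bool" where
  "shift_ergodic \<mu> \<longleftrightarrow>
     (\<forall>B\<in>sets \<mu>. shift -` B = B \<longrightarrow> measure \<mu> B = 0 \<or> measure \<mu> B = 1)"

definition kaenmaki_measure ::
    "('a::finite \<Rightarrow> real^2^2) \<Rightarrow> (nat \<Rightarrow> 'a) measure \<Rightarrow> bool" where
  "kaenmaki_measure A \<mu> \<longleftrightarrow>
     sets \<mu> = sets word_borel \<and> prob_space \<mu> \<and> shift_invariant \<mu> \<and> shift_ergodic \<mu> \<and>
     (\<exists>c>0. \<forall>w.
        inverse c * sv_fun (affinity_dim A) (mat_word A w) \<le> measure \<mu> (cylinder w) \<and>
        measure \<mu> (cylinder w) \<le> c * sv_fun (affinity_dim A) (mat_word A w))"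

section \<open>The open bounded neighbourhood condition\<close>

definition stopping_words :: "('a::finite \<Rightarrow> real^2^2) \<Rightarrow> (real^2) set \<Rightarrow> real \<Rightarrow> 'a list set" where
  "stopping_words A X r =
     {w. w \<noteq> [] \<and> alpha2 (mat_word A w) * diameter X \<le> r \<and>
         r < alpha2 (mat_word A (butlast w)) * diameter X}"

definition obnc ::
    "('a::finite \<Rightarrow> real^2^2) \<Rightarrow> ('a \<Rightarrow> real^2) \<Rightarrow> (real^2) set \<Rightarrow> bool" where
  "obnc A t X \<longleftrightarrow>
     (\<exists>U. U \<noteq> {} \<and> open U \<and> bounded U \<and> (\<forall>i. aff A t i ` U \<subseteq> U) \<and>
        (\<exists>C::real. C > 0 \<and> (\<forall>r>0. \<forall>x.
           finite {w \<in> stopping_words A X r. aff_word A t w ` U \<inter> ball x r \<noteq> {}} \<and>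
           real (card {w \<in> stopping_words A X r. aff_word A t w ` U \<inter> ball x r \<noteq> {}}) \<le> C)))"

section \<open>Hausdorff measure and projections\<close>

text \<open>Boundedness of the covering sets is explicit because \<^const>\<open>diameter\<close> has no meaningful value
  on unbounded sets. Finite covers are included through \<open>U i = {}\<close>. For \<open>s = 0\<close> this is not
  counting measure, since \<open>0 powr 0 = 0\<close>; only \<open>s > 0\<close> is intended.\<close>

definition hausdorff_pre :: "real \<Rightarrow> real \<Rightarrow> (real^2) set \<Rightarrow> ennreal" where
  "hausdorff_pre s \<delta> E =
     (INF U \<in> {U :: nat \<Rightarrow> (real^2) set.
                 E \<subseteq> (\<Union>i. U i) \<and> (\<forall>i. bounded (U i) \<and> diameter (U i) < \<delta>)}.
        \<Sum>i. ennreal (diameter (U i) powr s))"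

definition hausdorff :: "real \<Rightarrow> (real^2) set \<Rightarrow> ennreal" where
  "hausdorff s E = Lim (at_right 0) (\<lambda>\<delta>. hausdorff_pre s \<delta> E)"

definition orth_proj :: "(real^2) set \<Rightarrow> real^2 \<Rightarrow> real^2" where
  "orth_proj V x = (THE y. y \<in> V \<and> (\<forall>v\<in>V. orthogonal (x - y) v))"

definition proj_measure ::
    "('a::finite \<Rightarrow> real^2^2) \<Rightarrow> ('a \<Rightarrow> real^2) \<Rightarrow> (nat \<Rightarrow> 'a) measure \<Rightarrow> (real^2) set \<Rightarrow> (real^2) measure"
  where
  "proj_measure A t \<mu> V =
     distr (distr \<mu> borel (natural_proj A t)) (restrict_space borel V) (orth_proj V)"

end

theory Submission
  imports Defs
begin

text \<open>
  Only cylinder estimates enter: for \<open>1 < s \<le> 2\<close> one has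
  \<open>\<phi>\<^sup>s(M) = \<alpha>\<^sub>1(M)\<^bsup>2-s\<^esup> |det M|\<^bsup>s-1\<^esup>\<close>, which is submultiplicative, and the multicone
  makes \<open>\<alpha>\<^sub>1\<close> almost supermultiplicative, so the measure is quasi-Bernoulli on cylinders.

  (2) implies (1). A disc of radius \<open>r\<close> meets boundedly many cylinders \<open>f\<^sub>w(X)\<close> with
  \<open>\<alpha>\<^sub>2(A\<^sub>w) |X|\<close> comparable to \<open>r\<close>. Its preimage under \<open>f\<^sub>w\<close> lies, inside \<open>X\<close>, in a strip of width
  comparable to \<open>r / \<alpha>\<^sub>1(A\<^sub>w)\<close> orthogonal to a Furstenberg direction, whence the disc has mass at most
  a constant times \<open>\<alpha>\<^sub>1 \<alpha>\<^sub>2\<^bsup>s-1\<^esup> r / \<alpha>\<^sub>1\<close>, that is, at most a constant times \<open>r\<^sup>s\<close>.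

  (1) implies (2). If a strip of width \<open>r\<close> has mass more than \<open>M r\<close>, a suitable \<open>f\<^sub>w\<close> squeezes it into
  a disc of radius \<open>\<rho>\<close> and mass at least a constant times \<open>M \<rho>\<^sup>s\<close>. A fixed proportion of every
  cylinder consists of copies of this disc, and these can be covered at cost \<open>O(1/M)\<close> per unit of
  mass. Iterating over what remains covers all of \<open>X\<close> at total cost \<open>O(1/M)\<close>, so that
  \<open>\<H>\<^sup>s(X) = 0\<close> when \<open>M\<close> is arbitrary.
\<close>

section \<open>Singular values in the plane\<close>

text \<open>The signed area spanned by two vectors. It vanishes exactly for parallel vectors and a
  matrix multiplies it by its determinant, so it converts bounds on angles into bounds on
  stretching.\<close>

definition cross2 :: "real^2 \<Rightarrow> real^2 \<Rightarrow> real" where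
  "cross2 x y = x $ 1 * y $ 2 - x $ 2 * y $ 1"

lemma inner_2: "x \<bullet> y = x $ 1 * y $ 1 + x $ 2 * y $ 2" for x y :: "real^2"
  by (simp add: inner_vec_def sum_2)

lemma norm_2_sq: "(norm x)\<^sup>2 = (x $ 1)\<^sup>2 + (x $ 2)\<^sup>2" for x :: "real^2"
  by (metis inner_2 power2_eq_square power2_norm_eq_inner)

lemma vec_eq_2: "x = y \<longleftrightarrow> x $ 1 = y $ 1 \<and> x $ 2 = y $ 2" for x y :: "real^2"
  by (simp add: vec_eq_iff forall_2)

lemma matrix_vector_2:
  "(M *v x) $ 1 = M $ 1 $ 1 * x $ 1 + M $ 1 $ 2 * x $ 2"
  "(M *v x) $ 2 = M $ 2 $ 1 * x $ 1 + M $ 2 $ 2 * x $ 2" for M :: "real^2^2"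
  by (simp_all add: matrix_vector_mult_def sum_2)

lemma cross2_mult: "cross2 (M *v x) (M *v y) = det M * cross2 x y"
  unfolding cross2_def matrix_vector_2 det_2 by algebra

text \<open>Lagrange's identity in the plane.\<close>

lemma cross2_inner_sq: "(cross2 x y)\<^sup>2 + (x \<bullet> y)\<^sup>2 = (norm x)\<^sup>2 * (norm y)\<^sup>2"
  unfolding cross2_def inner_2 norm_2_sq by algebra

lemma abs_cross2_le: "\<bar>cross2 x y\<bar> \<le> norm x * norm y"
proof (rule power2_le_imp_le)
  show "\<bar>cross2 x y\<bar>\<^sup>2 \<le> (norm x * norm y)\<^sup>2"
    using cross2_inner_sq[of x y] by (simp add: power_mult_distrib) (smt (verit) zero_le_power2)
qed simp

lemma eigenvals_sym:
  fixes a b c :: real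
  assumes N: "N $ 1 $ 1 = a" "N $ 1 $ 2 = b" "N $ 2 $ 1 = b" "N $ 2 $ 2 = c"
  shows "eigenvals N = {l. (a - l) * (c - l) = b\<^sup>2}"
proof (intro set_eqI iffI)
  fix l assume "l \<in> eigenvals N"
  then obtain v where v: "v \<noteq> 0" "N *v v = l *\<^sub>R v" by (auto simp: eigenvals_def)
  have e: "a * v $ 1 + b * v $ 2 = l * v $ 1" "b * v $ 1 + c * v $ 2 = l * v $ 2"
    using v(2) by (auto simp: vec_eq_2 matrix_vector_2 N)
  have "((a - l) * (c - l) - b\<^sup>2) * v $ 1 = 0" "((a - l) * (c - l) - b\<^sup>2) * v $ 2 = 0"
    using e by algebra+
  then show "l \<in> {l. (a - l) * (c - l) = b\<^sup>2}" using v(1) by (auto simp: vec_eq_2)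
next
  fix l assume "l \<in> {l. (a - l) * (c - l) = b\<^sup>2}"
  then have l: "(a - l) * (c - l) = b\<^sup>2" by simp
  have *: "l \<in> eigenvals N" if "x \<noteq> 0 \<or> y \<noteq> 0" "a * x + b * y = l * x" "b * x + c * y = l * y" for x y
    unfolding eigenvals_def mem_Collect_eq
    by (rule exI[of _ "vector [x, y]"]) (use that in \<open>auto simp: vec_eq_2 matrix_vector_2 N\<close>)
  show "l \<in> eigenvals N"
  proof (cases "b = 0 \<and> l = a")
    case True
    then show ?thesis by (intro *[of 1 0]) auto
  next
    case False
    \<comment> \<open>The vector (b, l - a) solves the first row identically and the second by the
      characteristic equation; it vanishes only in the case treated before.\<close>
    show ?thesis by (rule *[of b "l - a"]) (use False l in \<open>auto simp: power2_eq_square algebra_simps\<close>)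
  qed
qed

text \<open>The Gram matrix \<open>N\<close> is diagonalised by hand: \<open>l1\<close> and
  \<open>l2\<close> are the roots of its characteristic polynomial, \<open>v1\<close> is a unit
  eigenvector for \<open>l1\<close>, and \<open>v2\<close> is \<open>v1\<close> turned by a right
  angle. This links the eigenvalue definitions of \<open>alpha1\<close> and \<open>alpha2\<close> to
  lengths of image vectors.\<close>

lemma singular_value_decomposition:
  obtains v1 v2 where "norm v1 = 1" "norm v2 = 1" "v1 \<bullet> v2 = 0"
    "0 \<le> alpha2 M" "alpha2 M \<le> alpha1 M" "alpha1 M * alpha2 M = \<bar>det M\<bar>"
    "\<And>z. (norm (M *v z))\<^sup>2 = (alpha1 M)\<^sup>2 * (z \<bullet> v1)\<^sup>2 + (alpha2 M)\<^sup>2 * (z \<bullet> v2)\<^sup>2"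
proof -
  define N where "N = transpose M ** M"
  define a where "a = N $ 1 $ 1"
  define b where "b = N $ 1 $ 2"
  define c where "c = N $ 2 $ 2"
  have b': "N $ 2 $ 1 = b"
    by (simp add: b_def N_def matrix_matrix_mult_def sum_2 transpose_def mult.commute)
  have quad: "(norm (M *v z))\<^sup>2 = a * (z $ 1)\<^sup>2 + 2 * b * (z $ 1 * z $ 2) + c * (z $ 2)\<^sup>2" for z
    unfolding norm_2_sq matrix_vector_2 a_def b_def c_def N_def
    by (simp add: matrix_matrix_mult_def sum_2 transpose_def power2_eq_square algebra_simps)
  \<comment> \<open>The square root of the discriminant of the characteristic polynomial of
    \<open>N\<close>.\<close>
  define D where "D = sqrt ((a - c)\<^sup>2 + 4 * b\<^sup>2)"
  have D: "D\<^sup>2 = (a - c)\<^sup>2 + 4 * b\<^sup>2" "D \<ge> 0" by (auto simp: D_def)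
  define l1 where "l1 = (a + c + D) / 2"
  define l2 where "l2 = (a + c - D) / 2"
  have "(a - l) * (c - l) - b\<^sup>2 = (l - l1) * (l - l2)" for l
  proof -
    have "4 * ((a - l) * (c - l) - b\<^sup>2) = (2 * l - (a + c))\<^sup>2 - ((a - c)\<^sup>2 + 4 * b\<^sup>2)" by algebra
    also have "\<dots> = 4 * ((l - l1) * (l - l2))"
      unfolding D(1)[symmetric] l1_def l2_def by (simp add: field_simps power2_eq_square)
    finally show ?thesis by simp
  qed
  then have "(a - l) * (c - l) = b\<^sup>2 \<longleftrightarrow> l = l1 \<or> l = l2" for l
    by (metis eq_iff_diff_eq_0 mult_eq_0_iff)
  then have ev: "eigenvals N = {l1, l2}"
    using eigenvals_sym[of N a b c] b' by (auto simp: a_def b_def c_def)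
  have l12: "l2 \<le> l1" using D by (simp add: l1_def l2_def)
  have a1: "alpha1 M = sqrt l1" and a2: "alpha2 M = sqrt l2"
    unfolding alpha1_def alpha2_def N_def[symmetric] ev using l12 by (simp_all add: max_def min_def)
  obtain v where v: "v \<noteq> 0" "N *v v = l1 *\<^sub>R v" using ev by (auto simp: eigenvals_def)
  define v1 where "v1 = (1 / norm v) *\<^sub>R v"
  have v1: "norm v1 = 1" "N *v v1 = l1 *\<^sub>R v1"
    using v by (auto simp: v1_def matrix_vector_mult_scaleR)
  define v2 :: "real^2" where "v2 = vector [- v1 $ 2, v1 $ 1]"
  have v2c: "v2 $ 1 = - v1 $ 2" "v2 $ 2 = v1 $ 1" by (auto simp: v2_def)
  define p where "p = v1 $ 1"
  define q where "q = v1 $ 2"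
  have pq: "p\<^sup>2 + q\<^sup>2 = 1" using norm_2_sq[of v1] v1(1) by (simp add: p_def q_def)
  have e: "a * p + b * q = l1 * p" "b * p + c * q = l1 * q"
    using v1(2) b' by (auto simp: vec_eq_2 matrix_vector_2 p_def q_def a_def b_def c_def)
  have tr: "l1 + l2 = a + c" by (simp add: l1_def l2_def field_simps)
  \<comment> \<open>The spectral decomposition in coordinates; the eigenvector equations for
    \<open>v1\<close> together with the trace determine all entries.\<close>
  have abc: "a = l1 * p\<^sup>2 + l2 * q\<^sup>2" "b = (l1 - l2) * (p * q)" "c = l1 * q\<^sup>2 + l2 * p\<^sup>2"
    using e tr pq by algebra+
  have form: "(norm (M *v z))\<^sup>2 = l1 * (z \<bullet> v1)\<^sup>2 + l2 * (z \<bullet> v2)\<^sup>2" for z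
    unfolding quad inner_2 v2c p_def[symmetric] q_def[symmetric] abc
    by (simp add: power2_eq_square algebra_simps)
  have n2: "norm v2 = 1"
    using norm_2_sq[of v2] pq norm_ge_zero[of v2] by (simp add: v2c p_def q_def power2_eq_1_iff add.commute) (smt (verit) norm_ge_zero)
  have ov: "v1 \<bullet> v2 = 0" by (simp add: inner_2 v2c)
  have "l2 = (norm (M *v v2))\<^sup>2"
    using form[of v2] ov n2 power2_norm_eq_inner[of v2] by (simp add: inner_commute)
  then have l2: "l2 \<ge> 0" by simp
  have "l1 * l2 = (det M)\<^sup>2"
  proof -
    have "l1 * l2 = a * c - b\<^sup>2" using abc pq by algebra
    also have "\<dots> = (det M)\<^sup>2"
      unfolding a_def b_def c_def N_def det_2
      by (simp add: matrix_matrix_mult_def sum_2 transpose_def power2_eq_square algebra_simps)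
    finally show ?thesis .
  qed
  then have "alpha1 M * alpha2 M = \<bar>det M\<bar>"
    using a1 a2 by (simp flip: real_sqrt_mult)
  moreover have "(norm (M *v z))\<^sup>2 = (alpha1 M)\<^sup>2 * (z \<bullet> v1)\<^sup>2 + (alpha2 M)\<^sup>2 * (z \<bullet> v2)\<^sup>2" for z
    using form l2 l12 a1 a2 by simp
  ultimately show ?thesis
    using v1(1) n2 ov l2 l12 a1 a2 by (intro that[of v1 v2]) auto
qed

lemma orthonormal_2_norm:
  fixes z :: "real^2"
  assumes "norm v1 = 1" "norm v2 = 1" "v1 \<bullet> v2 = 0"
  shows "(z \<bullet> v1)\<^sup>2 + (z \<bullet> v2)\<^sup>2 = (norm z)\<^sup>2"
proof -
  have e: "(v1 $ 1)\<^sup>2 + (v1 $ 2)\<^sup>2 = 1" "(v2 $ 1)\<^sup>2 + (v2 $ 2)\<^sup>2 = 1"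
    "v1 $ 1 * v2 $ 1 + v1 $ 2 * v2 $ 2 = 0"
    using assms norm_2_sq[of v1] norm_2_sq[of v2] by (auto simp: inner_2)
  then have "(v1 $ 1)\<^sup>2 + (v2 $ 1)\<^sup>2 = 1" "(v1 $ 2)\<^sup>2 + (v2 $ 2)\<^sup>2 = 1"
    "v1 $ 1 * v1 $ 2 + v2 $ 1 * v2 $ 2 = 0"
    by algebra+
  then show ?thesis unfolding inner_2 norm_2_sq by algebra
qed

lemma alpha_nonneg: "0 \<le> alpha2 M" "alpha2 M \<le> alpha1 M" "0 \<le> alpha1 M"
  by (rule singular_value_decomposition[of M], linarith)+

lemma alpha_det: "alpha1 M * alpha2 M = \<bar>det M\<bar>"
  by (rule singular_value_decomposition[of M])

lemma alpha_pos: "det M \<noteq> 0 \<Longrightarrow> 0 < alpha2 M" "det M \<noteq> 0 \<Longrightarrow> 0 < alpha1 M"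
  using alpha_det[of M] alpha_nonneg[of M] by (metis abs_eq_0 less_eq_real_def mult_zero_left mult_zero_right)+

lemma norm_mult_le_alpha1: "norm (M *v z) \<le> alpha1 M * norm z"
proof (rule singular_value_decomposition[of M])
  fix v1 v2 assume on: "norm v1 = 1" "norm v2 = 1" "v1 \<bullet> v2 = 0"
    and a: "0 \<le> alpha2 M" "alpha2 M \<le> alpha1 M"
    and f: "\<And>z. (norm (M *v z))\<^sup>2 = (alpha1 M)\<^sup>2 * (z \<bullet> v1)\<^sup>2 + (alpha2 M)\<^sup>2 * (z \<bullet> v2)\<^sup>2"
  have "(norm (M *v z))\<^sup>2 \<le> (alpha1 M)\<^sup>2 * (z \<bullet> v1)\<^sup>2 + (alpha1 M)\<^sup>2 * (z \<bullet> v2)\<^sup>2"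
    unfolding f using a by (intro add_left_mono mult_right_mono power_mono) auto
  also have "\<dots> = (alpha1 M * norm z)\<^sup>2"
    using orthonormal_2_norm[OF on, of z] by algebra
  finally show ?thesis by (rule power2_le_imp_le) (use alpha_nonneg in auto)
qed

lemma alpha2_le_norm_mult: "alpha2 M * norm z \<le> norm (M *v z)"
proof (rule singular_value_decomposition[of M])
  fix v1 v2 assume on: "norm v1 = 1" "norm v2 = 1" "v1 \<bullet> v2 = 0"
    and a: "0 \<le> alpha2 M" "alpha2 M \<le> alpha1 M"
    and f: "\<And>z. (norm (M *v z))\<^sup>2 = (alpha1 M)\<^sup>2 * (z \<bullet> v1)\<^sup>2 + (alpha2 M)\<^sup>2 * (z \<bullet> v2)\<^sup>2"
  have "(alpha2 M * norm z)\<^sup>2 = (alpha2 M)\<^sup>2 * (z \<bullet> v1)\<^sup>2 + (alpha2 M)\<^sup>2 * (z \<bullet> v2)\<^sup>2"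
    using orthonormal_2_norm[OF on, of z] by algebra
  also have "\<dots> \<le> (norm (M *v z))\<^sup>2"
    unfolding f using a by (intro add_right_mono mult_right_mono power_mono) auto
  finally show ?thesis by (rule power2_le_imp_le) auto
qed

text \<open>Besides vectors attaining both singular values, this records the shape of the image
  ellipse: only the component along \<open>v1\<close> is stretched by \<open>alpha1\<close>.\<close>

lemma singular_vectors:
  obtains v1 v2 where "norm v1 = 1" "norm v2 = 1"
    "norm (M *v v1) = alpha1 M" "norm (M *v v2) = alpha2 M"
    "\<And>z. norm (M *v z) \<le> alpha1 M * \<bar>z \<bullet> v1\<bar> + alpha2 M * norm z"
proof (rule singular_value_decomposition[of M])
  fix v1 v2 assume on: "norm v1 = 1" "norm v2 = 1" "v1 \<bullet> v2 = 0"
    and a: "0 \<le> alpha2 M" "alpha2 M \<le> alpha1 M"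
    and f: "\<And>z. (norm (M *v z))\<^sup>2 = (alpha1 M)\<^sup>2 * (z \<bullet> v1)\<^sup>2 + (alpha2 M)\<^sup>2 * (z \<bullet> v2)\<^sup>2"
  have i: "v1 \<bullet> v1 = 1" "v2 \<bullet> v2 = 1" "v2 \<bullet> v1 = 0"
    using on by (auto simp: inner_commute simp flip: power2_norm_eq_inner)
  have 1: "norm (M *v v1) = alpha1 M" "norm (M *v v2) = alpha2 M"
    using f[of v1] f[of v2] i on(3) a by (simp_all)
  have "norm (M *v z) \<le> alpha1 M * \<bar>z \<bullet> v1\<bar> + alpha2 M * norm z" for z
  proof (rule power2_le_imp_le)
    have "(z \<bullet> v2)\<^sup>2 \<le> (norm z)\<^sup>2"
      using orthonormal_2_norm[OF on, of z] by (smt (verit) zero_le_power2)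
    then have "(norm (M *v z))\<^sup>2 \<le> (alpha1 M * \<bar>z \<bullet> v1\<bar>)\<^sup>2 + (alpha2 M * norm z)\<^sup>2"
      unfolding f by (simp add: power_mult_distrib mult_left_mono)
    also have "\<dots> \<le> (alpha1 M * \<bar>z \<bullet> v1\<bar> + alpha2 M * norm z)\<^sup>2"
      using a by (simp add: power2_sum)
    finally show "(norm (M *v z))\<^sup>2 \<le> (alpha1 M * \<bar>z \<bullet> v1\<bar> + alpha2 M * norm z)\<^sup>2" .
  qed (use a in auto)
  then show ?thesis using on 1 by (intro that) auto
qed

lemma alpha1_mult_le: "alpha1 (M ** N) \<le> alpha1 M * alpha1 N"
proof (rule singular_vectors[of "M ** N"])
  fix v1 assume v: "norm v1 = 1" "norm ((M ** N) *v v1) = alpha1 (M ** N)"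
  have "alpha1 (M ** N) = norm (M *v (N *v v1))" using v by (simp add: matrix_vector_mul_assoc)
  also have "\<dots> \<le> alpha1 M * (alpha1 N * norm v1)"
    by (meson alpha_nonneg mult_left_mono norm_mult_le_alpha1 order_trans)
  finally show ?thesis using v by simp
qed

lemma alpha2_mult_ge: "alpha2 M * alpha2 N \<le> alpha2 (M ** N)"
proof (rule singular_vectors[of "M ** N"])
  fix v2 assume v: "norm v2 = 1" "norm ((M ** N) *v v2) = alpha2 (M ** N)"
  have "alpha2 M * (alpha2 N * norm v2) \<le> norm (M *v (N *v v2))"
    by (meson alpha_nonneg mult_left_mono alpha2_le_norm_mult order_trans)
  also have "\<dots> = alpha2 (M ** N)" using v by (simp add: matrix_vector_mul_assoc)
  finally show ?thesis using v by simp
qed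

text \<open>Duality: for \<open>u = transpose M *v v\<close> the squared length of \<open>u\<close>
  is \<open>(M *v u) \<bullet> v\<close>. This gives one inequality for every matrix; applied to the
  transpose it gives the other.\<close>

lemma alpha1_transpose: "alpha1 (transpose M) = alpha1 M"
proof -
  have *: "alpha1 (transpose M) \<le> alpha1 M" for M
  proof (rule singular_vectors[of "transpose M"])
    fix v assume v: "norm v = 1" "norm (transpose M *v v) = alpha1 (transpose M)"
    define u where "u = transpose M *v v"
    have "(norm u)\<^sup>2 = (M *v u) \<bullet> v"
      unfolding power2_norm_eq_inner
      by (metis dot_lmul_matrix inner_commute transpose_matrix_vector u_def)
    also have "\<dots> \<le> norm (M *v u) * norm v" by (rule norm_cauchy_schwarz)
    also have "\<dots> \<le> alpha1 M * norm u" using norm_mult_le_alpha1[of M u] v by simp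
    finally have "norm u \<le> alpha1 M"
      using alpha_nonneg(3)[of M] by (cases "norm u = 0") (auto simp: power2_eq_square)
    then show ?thesis using v by (simp add: u_def)
  qed
  show ?thesis using *[of M] *[of "transpose M"] by simp
qed

lemma alpha2_transpose: 
  assumes "det M \<noteq> 0"
  shows "alpha2 (transpose M) = alpha2 M"
  using alpha_det[of M] alpha_det[of "transpose M"] alpha1_transpose[of M] alpha_pos[OF assms]
  by (metis det_transpose less_irrefl mult_cancel_left)

lemma alpha1_le:
  assumes "\<And>z. norm (M *v z) \<le> c * norm z"
  shows "alpha1 M \<le> c"
  by (rule singular_vectors[of M]) (metis assms mult.right_neutral)

lemma alpha_one: "alpha1 (mat 1) = 1" "alpha2 (mat 1) = 1"
  by (rule singular_vectors[of "mat 1"], simp)+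

lemma inner_transpose: "(M *v z) \<bullet> v = z \<bullet> (transpose M *v v)" for M :: "real^'n^'m"
  by (metis dot_lmul_matrix inner_commute transpose_matrix_vector)

section \<open>Words and the multicone\<close>

declare transpose_matrix_vector [simp del]

lemma span_unit_eq:
  fixes u v :: "real^2"
  assumes "norm u = 1" "norm v = 1" "span {u} = span {v}"
  shows "v = u \<or> v = - u"
proof -
  have "v \<in> span {u}" using assms(3) by (simp add: span_base)
  then obtain k where k: "v = k *\<^sub>R u" by (auto simp: span_singleton)
  then have "\<bar>k\<bar> = 1" using assms by simp
  then show ?thesis using k by (auto simp: abs_if split: if_splits)
qed

lemma span_singleton_scale:
  assumes "c \<noteq> 0"
  shows "span {c *\<^sub>R v} = span {v :: 'b :: real_vector}"
proof -
  have "k *\<^sub>R v \<in> range (\<lambda>k. (k * c) *\<^sub>R v)" for k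
    by (rule image_eqI[of _ _ "k / c"]) (use assms in auto)
  then show ?thesis by (auto simp: span_singleton)
qed

lemma rp1_E:
  assumes "V \<in> rp1"
  obtains v where "norm v = 1" "V = span {v}"
proof -
  have V: "subspace V" "dim V = 1" using assms by (auto simp: rp1_def)
  obtain B where B: "B \<subseteq> V" "independent B" "V \<subseteq> span B" "card B = dim V"
    using basis_exists by blast
  then obtain b where b: "B = {b}" using V card_1_singletonE by metis
  then have "b \<noteq> 0" using B(2) dependent_zero by auto
  moreover have "V = span {b}" using B b V(1) by (metis span_subspace)
  ultimately show ?thesis
    by (intro that[of "(1 / norm b) *\<^sub>R b"]) (auto simp: span_singleton_scale)
qed

lemma rp1_act_span: "rp1_act M (span {v}) = span {M *v v}"
  unfolding rp1_act_def using linear_span_image[of "(*v) M" "{v}"] by simp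

text \<open>The circle is a double cover of the projective line, so the interval pulls back to two
  antipodal arcs, each a continuous image of a compact parameter interval.\<close>

lemma compact_unit_proj_interval:
  assumes "proj_interval I"
  shows "compact {v. norm v = 1 \<and> span {v} \<in> I}"
proof -
  obtain a b where I: "I = line_at ` {a..b}" using assms by (auto simp: proj_interval_def)
  define e :: "real \<Rightarrow> real^2" where "e \<theta> = vector [cos \<theta>, sin \<theta>]" for \<theta>
  have e: "e = (\<lambda>\<theta>. cos \<theta> *\<^sub>R axis 1 1 + sin \<theta> *\<^sub>R axis 2 1)"
    by (auto simp: e_def vec_eq_2 axis_def)
  have c: "continuous_on {a..b} e" unfolding e by (intro continuous_intros)
  have n: "norm (e \<theta>) = 1" for \<theta>
    using norm_2_sq[of "e \<theta>"] norm_ge_zero[of "e \<theta>"] by (simp add: e_def power2_eq_1_iff)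
      (smt (verit) norm_ge_zero)
  have "{v. norm v = 1 \<and> span {v} \<in> I} = e ` {a..b} \<union> (\<lambda>\<theta>. - e \<theta>) ` {a..b}"
  proof (intro set_eqI iffI)
    fix v assume "v \<in> {v. norm v = 1 \<and> span {v} \<in> I}"
    then obtain \<theta> where "norm v = 1" "\<theta> \<in> {a..b}" "span {v} = span {e \<theta>}"
      by (auto simp: I line_at_def e_def)
    then show "v \<in> e ` {a..b} \<union> (\<lambda>\<theta>. - e \<theta>) ` {a..b}"
      using span_unit_eq[of "e \<theta>" v] n[of \<theta>] by auto
  next
    fix v assume "v \<in> e ` {a..b} \<union> (\<lambda>\<theta>. - e \<theta>) ` {a..b}"
    then obtain \<theta> where t: "\<theta> \<in> {a..b}" "v = e \<theta> \<or> v = - e \<theta>" by auto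
    then have "span {v} = span {e \<theta>}" using span_singleton_scale[of "-1" "e \<theta>"] by auto
    then show "v \<in> {v. norm v = 1 \<and> span {v} \<in> I}"
      using t n[of \<theta>] by (auto simp: I line_at_def e_def)
  qed
  moreover have "compact (e ` {a..b} \<union> (\<lambda>\<theta>. - e \<theta>) ` {a..b})"
    by (intro compact_Un compact_continuous_image c continuous_intros) auto
  ultimately show ?thesis by simp
qed

lemma mat_word_simps [simp]:
  "mat_word A [] = mat 1" "mat_word A (i # w) = A i ** mat_word A w"
  by (simp_all add: mat_word_def)

lemma mat_word_append: "mat_word A (u @ v) = mat_word A u ** mat_word A v"
  by (induction u) (auto simp: matrix_mul_assoc)

lemma aff_word_simps [simp]:
  "aff_word A t [] x = x" "aff_word A t (i # w) x = aff A t i (aff_word A t w x)"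
  by (simp_all add: aff_word_def)

lemma aff_word_append: "aff_word A t (u @ v) x = aff_word A t u (aff_word A t v x)"
  by (induction u) auto

lemma aff_word_diff: "aff_word A t w x - aff_word A t w y = mat_word A w *v (x - y)"
proof (induction w)
  case (Cons i w)
  then show ?case
    by (simp add: aff_def matrix_vector_mul_assoc[symmetric] flip: matrix_vector_mult_diff_distrib)
qed auto

lemma dist_aff_word_le: "dist (aff_word A t w x) (aff_word A t w y) \<le> alpha1 (mat_word A w) * dist x y"
  by (simp add: dist_norm aff_word_diff norm_mult_le_alpha1)

lemma det_mat_word: "(\<And>i. det (A i) \<noteq> 0) \<Longrightarrow> det (mat_word A w) \<noteq> 0"
  by (induction w) (auto simp: det_mul)

section \<open>Contraction rates and transversality in a multicone\<close>

locale multicone =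
  fixes A :: "'a::finite \<Rightarrow> real^2^2" and t :: "'a \<Rightarrow> real^2" and \<C> :: "(real^2) set set"
  assumes ifs: "affine_ifs A t" and cone: "strongly_invariant_multicone A \<C>"
begin

abbreviation a1 :: "'a list \<Rightarrow> real" where "a1 w \<equiv> alpha1 (mat_word A w)"
abbreviation a2 :: "'a list \<Rightarrow> real" where "a2 w \<equiv> alpha2 (mat_word A w)"

text \<open>Since \<open>mat_word A (w @ [i]) = mat_word A w ** A i\<close>, appending a letter to \<open>w\<close> applies
  \<open>transpose (A i)\<close> last; thus \<open>T w\<close> is \<open>adj_word A (rev w)\<close>.\<close>

abbreviation T :: "'a list \<Rightarrow> real^2^2" where "T w \<equiv> transpose (mat_word A w)"

text \<open>Vectors in place of lines: \<open>K\<close> carries the compactness, while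
  \<open>Cone\<close> is stable under nonzero scaling and under every \<open>T w\<close>.\<close>

definition K :: "(real^2) set" where "K = {v. norm v = 1 \<and> span {v} \<in> \<C>}"
definition Cone :: "(real^2) set" where "Cone = {v. v \<noteq> 0 \<and> span {v} \<in> \<C>}"

lemma detA: "det (A i) \<noteq> 0" using ifs by (simp add: affine_ifs_def)
lemma det_word: "det (mat_word A w) \<noteq> 0" by (rule det_mat_word[OF detA])

lemma a_pos: "0 < a1 w" "0 < a2 w" using alpha_pos[OF det_word] by auto

text \<open>No letter shrinks a vector by more than this factor; it pays for splitting off one
  letter and for overshooting a threshold by one letter.\<close>

definition \<kappa> :: real where "\<kappa> = Min (range (\<lambda>i. alpha2 (A i)))"

lemma kappa_pos: "0 < \<kappa>" unfolding \<kappa>_def by (subst Min_gr_iff) (auto simp: alpha_pos detA)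
lemma kappa_le: "\<kappa> \<le> alpha2 (A i)" unfolding \<kappa>_def by (rule Min_le) auto

definition \<Lambda> :: real where "\<Lambda> = Max (range (\<lambda>i. alpha1 (A i)))"

lemma alpha1_lt_1: "alpha1 (A i) < 1"
proof -
  have "alpha1 (A i) \<le> onorm ((*v) (A i))"
    by (rule alpha1_le) (rule onorm, rule matrix_vector_mul_bounded_linear)
  then show ?thesis using ifs by (auto simp: affine_ifs_def intro: order_le_less_trans)
qed

lemma Lambda: "0 < \<Lambda>" "\<Lambda> < 1" "alpha1 (A i) \<le> \<Lambda>"
proof -
  have le: "alpha1 (A i) \<le> \<Lambda>" for i unfolding \<Lambda>_def by (rule Max_ge) auto
  then show "alpha1 (A i) \<le> \<Lambda>" .
  show "0 < \<Lambda>" by (rule less_le_trans[OF _ le]) (rule alpha_pos[OF detA])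
  show "\<Lambda> < 1" unfolding \<Lambda>_def by (subst Max_less_iff) (auto simp: alpha1_lt_1)
qed

lemma a1_le: "a1 w \<le> \<Lambda> ^ length w"
proof (induction w)
  case (Cons i w)
  have "a1 (i # w) \<le> alpha1 (A i) * a1 w" by (simp add: alpha1_mult_le)
  also have "\<dots> \<le> \<Lambda> * \<Lambda> ^ length w"
    by (intro mult_mono Lambda Cons.IH) (use Lambda(1) alpha_nonneg in \<open>auto simp: less_imp_le\<close>)
  finally show ?case by simp
qed (simp add: alpha_one)

lemma a1_small: 
  assumes "0 < e"
  obtains n where "\<And>w. length w \<ge> n \<Longrightarrow> a1 w < e"
proof -
  obtain n where "\<Lambda> ^ n < e" using real_arch_pow_inv[OF assms Lambda(2)] by auto
  moreover have "\<Lambda> ^ m \<le> \<Lambda> ^ n" if "m \<ge> n" for m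
    using that Lambda(1,2) by (intro power_decreasing) auto
  ultimately show ?thesis using a1_le by (intro that[of n]) (meson order_le_less_trans)
qed

lemma C_rp1: "\<C> \<subseteq> rp1" "\<C> \<noteq> {}" "\<C> \<noteq> rp1"
  using cone by (auto simp: strongly_invariant_multicone_def)

lemma C_interior: "V \<in> \<C> \<Longrightarrow> rp1_act (transpose (A i)) V \<in> rp1_topology interior_of \<C>"
  using cone unfolding strongly_invariant_multicone_def by blast

lemma compact_K: "compact K"
proof -
  obtain \<I> where I: "finite \<I>" "\<forall>I\<in>\<I>. proj_interval I" and C: "\<C> = \<Union>\<I>"
    using cone unfolding strongly_invariant_multicone_def by auto
  then have "K = (\<Union>I\<in>\<I>. {v. norm v = 1 \<and> span {v} \<in> I})" unfolding K_def unfolding C by auto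
  then show ?thesis using I compact_unit_proj_interval by (auto intro!: compact_UN)
qed

lemma Cone_scale: "v \<in> Cone \<Longrightarrow> c \<noteq> 0 \<Longrightarrow> c *\<^sub>R v \<in> Cone"
  by (simp add: Cone_def span_singleton_scale)

lemma Cone_scale_iff: "c \<noteq> 0 \<Longrightarrow> c *\<^sub>R v \<in> Cone \<longleftrightarrow> v \<in> Cone"
  by (simp add: Cone_def span_singleton_scale)

lemma K_Cone: "v \<in> K \<longleftrightarrow> v \<in> Cone \<and> norm v = 1"
  by (auto simp: K_def Cone_def)

lemma transpose_nonzero: "v \<noteq> 0 \<Longrightarrow> det M \<noteq> 0 \<Longrightarrow> transpose M *v v \<noteq> 0" for M :: "real^2^2"
  using alpha2_le_norm_mult[of "transpose M" v] alpha_pos(1)[of "transpose M"]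
  by (metis det_transpose mult_pos_pos norm_zero not_le zero_less_norm_iff)

lemma Cone_step:
  assumes "v \<in> Cone"
  shows "transpose (A i) *v v \<in> Cone"
    and "span {transpose (A i) *v v} \<in> rp1_topology interior_of \<C>"
proof -
  show *: "span {transpose (A i) *v v} \<in> rp1_topology interior_of \<C>"
    using C_interior[of "span {v}" i] assms by (simp add: rp1_act_span Cone_def)
  then show "transpose (A i) *v v \<in> Cone"
    using interior_of_subset[of rp1_topology \<C>] assms detA[of i] transpose_nonzero
    by (auto simp: Cone_def)
qed

lemma T_snoc: "T (w @ [i]) *v v = transpose (A i) *v (T w *v v)"
  by (simp add: mat_word_append matrix_transpose_mul flip: matrix_vector_mul_assoc)

lemma T_Cons: "T (i # w) *v v = T w *v (transpose (A i) *v v)"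
  by (simp add: matrix_transpose_mul flip: matrix_vector_mul_assoc)

lemma Cone_T: "v \<in> Cone \<Longrightarrow> T w *v v \<in> Cone"
  by (induction w rule: rev_induct) (auto simp: transpose_mat T_snoc Cone_step simp del: mat_word_simps(2))

text \<open>Compactness: the normalised images of the cone under one letter form a compact set
  inside its interior, and the unit vectors outside the interior form another. Directions from the
  two sets are never parallel, so the area has a positive minimum; homogeneity removes the
  normalisation.\<close>

lemma uniform_transversality:
  obtains \<epsilon> where "\<epsilon> > 0"
    "\<And>v p i. v \<in> Cone \<Longrightarrow> p \<notin> Cone \<Longrightarrow>
       \<epsilon> * norm (transpose (A i) *v v) * norm p \<le> \<bar>cross2 (transpose (A i) *v v) p\<bar>"
proof -
  define Q where "Q = {v. v \<noteq> 0 \<and> span {v} \<in> rp1_topology interior_of \<C>}"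
  have "open Q" using openin_interior_of[of rp1_topology \<C>] unfolding openin_rp1_topology Q_def by auto
  have Q_Cone: "Q \<subseteq> Cone" using interior_of_subset[of rp1_topology \<C>] by (auto simp: Q_def Cone_def)
  define K1 where "K1 = (\<Union>i. (\<lambda>v. (1 / norm (transpose (A i) *v v)) *\<^sub>R (transpose (A i) *v v)) ` K)"
  \<comment> \<open>Removing only the open set \<open>Q\<close> keeps \<open>P\<close> compact; it
    still contains all unit vectors outside the cone.\<close>
  define P where "P = sphere 0 1 - Q"
  have K0: "transpose (A i) *v v \<noteq> 0" if "v \<in> K" for v i
    using that detA by (intro transpose_nonzero) (auto simp: K_def)
  have "compact K1" unfolding K1_def
    by (intro compact_UN compact_continuous_image continuous_intros compact_K
        linear_continuous_on matrix_vector_mul_bounded_linear) (auto simp: K0)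
  moreover have "compact P" unfolding P_def by (intro compact_diff \<open>open Q\<close>) auto
  ultimately have comp: "compact (K1 \<times> P)" by (rule compact_Times)
  have K1Q: "K1 \<subseteq> Q"
    unfolding K1_def Q_def using Cone_step(2) K0 by (auto simp: K_Cone span_singleton_scale)
  have K1n: "norm x = 1" if "x \<in> K1" for x using that K0 unfolding K1_def by auto
  have pos: "\<bar>cross2 x p\<bar> > 0" if x: "x \<in> K1" and p: "p \<in> P" for x p
  proof (rule ccontr)
    assume "\<not> ?thesis"
    then have c: "cross2 x p = 0" by simp
    have n: "norm x = 1" "norm p = 1" using K1n x p by (auto simp: P_def)
    then have "(x \<bullet> p)\<^sup>2 = 1" using cross2_inner_sq[of x p] c by simp
    \<comment> \<open>Equality in the Cauchy-Schwarz inequality makes both lines equal, although one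
      belongs to the interior and the other does not.\<close>
    then have "\<bar>x \<bullet> p\<bar> = norm x * norm p" using n by (simp add: power2_eq_1_iff) auto
    then have "p = x \<or> p = - x" using n norm_cauchy_schwarz_abs_eq[of x p] by auto
    then have "span {p} = span {x}" using span_singleton_scale[of "-1" x] by auto
    moreover have "x \<in> Q" using x K1Q by auto
    ultimately have "p \<in> Q" using n by (auto simp: Q_def)
    then show False using p by (auto simp: P_def)
  qed
  have "\<exists>\<epsilon>>0. \<forall>x\<in>K1. \<forall>p\<in>P. \<epsilon> \<le> \<bar>cross2 x p\<bar>"
  proof (cases "K1 \<times> P = {}")
    case True
    then show ?thesis by (intro exI[of _ 1]) auto
  next
    case False
    have "continuous_on (K1 \<times> P) (\<lambda>z. \<bar>cross2 (fst z) (snd z)\<bar>)"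
      unfolding cross2_def by (intro continuous_intros)
    then obtain z where "z \<in> K1 \<times> P" "\<forall>y\<in>K1 \<times> P. \<bar>cross2 (fst z) (snd z)\<bar> \<le> \<bar>cross2 (fst y) (snd y)\<bar>"
      using continuous_attains_inf[OF comp False] by blast
    then show ?thesis using pos by (intro exI[of _ "\<bar>cross2 (fst z) (snd z)\<bar>"]) force
  qed
  then obtain \<epsilon> where e: "\<epsilon> > 0" "\<And>x p. x \<in> K1 \<Longrightarrow> p \<in> P \<Longrightarrow> \<epsilon> \<le> \<bar>cross2 x p\<bar>" by blast
  show ?thesis
  proof (rule that[OF e(1)])
    fix v p i assume v: "v \<in> Cone" and p: "p \<notin> Cone"
    define x where "x = transpose (A i) *v v"
    have v0: "v \<noteq> 0" using v by (simp add: Cone_def)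
    have x0: "x \<noteq> 0" unfolding x_def by (rule transpose_nonzero[OF v0 detA])
    show "\<epsilon> * norm x * norm p \<le> \<bar>cross2 x p\<bar>"
    proof (cases "p = 0")
      case False
      define x' where "x' = (1 / norm x) *\<^sub>R x"
      define p' where "p' = (1 / norm p) *\<^sub>R p"
      have "x' = (1 / norm (transpose (A i) *v ((1 / norm v) *\<^sub>R v))) *\<^sub>R (transpose (A i) *v ((1 / norm v) *\<^sub>R v))"
        using v0 x0 by (simp add: x'_def x_def matrix_vector_mult_scaleR)
      moreover have "(1 / norm v) *\<^sub>R v \<in> K" using v v0 by (auto simp: K_Cone intro: Cone_scale)
      ultimately have "x' \<in> K1" unfolding K1_def by blast
      moreover have "p' \<in> P"
        using p False Q_Cone Cone_scale_iff[of "1 / norm p" p] by (auto simp: P_def p'_def)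
      ultimately have "\<epsilon> \<le> \<bar>cross2 x' p'\<bar>" by (rule e(2))
      also have "cross2 x' p' = cross2 x p / (norm x * norm p)"
        by (simp add: x'_def p'_def cross2_def diff_divide_distrib)
      finally show ?thesis using x0 False
        by (simp add: field_simps abs_mult)
    qed (simp add: cross2_def)
  qed
qed

text \<open>The multicone is proper and \<open>K\<close> is closed, so a direction outside it exists
  and can be rotated slightly without entering it.\<close>

lemma basis_outside_Cone:
  obtains q q' where "norm q = 1" "norm q' = 1" "q \<notin> Cone" "q' \<notin> Cone" "cross2 q q' \<noteq> 0"
proof -
  obtain V where V: "V \<in> rp1" "V \<notin> \<C>" using C_rp1 by auto
  obtain q where q: "norm q = 1" "V = span {q}" using rp1_E[OF V(1)] by blast
  have qK: "q \<notin> K" using q V by (simp add: K_def)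
  define q1 :: "real^2" where "q1 = vector [- q $ 2, q $ 1]"
  have q1: "q1 $ 1 = - q $ 2" "q1 $ 2 = q $ 1" by (auto simp: q1_def)
  have qq: "(q $ 1)\<^sup>2 + (q $ 2)\<^sup>2 = 1" using norm_2_sq[of q] q by simp
  define f where "f \<theta> = cos \<theta> *\<^sub>R q + sin \<theta> *\<^sub>R q1" for \<theta>
  have "open (f -` (- K))"
    unfolding f_def by (intro open_vimage continuous_intros) (use compact_K compact_imp_closed in auto)
  moreover have "0 \<in> f -` (- K)" using qK by (simp add: f_def)
  ultimately obtain e where e: "e > 0" "ball 0 e \<subseteq> f -` (- K)" using open_contains_ball by blast
  \<comment> \<open>Small enough to avoid \<open>K\<close>, and below \<open>pi\<close> so that the
    sine is positive.\<close>
  define \<theta> where "\<theta> = min (e / 2) 1"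
  have th: "0 < \<theta>" "\<theta> \<le> 1" "\<theta> < e" using e by (auto simp: \<theta>_def)
  have "f \<theta> \<notin> K" using subsetD[OF e(2), of \<theta>] th by simp
  moreover have "(norm (f \<theta>))\<^sup>2 = 1"
  proof -
    have "(norm (f \<theta>))\<^sup>2 = ((q $ 1)\<^sup>2 + (q $ 2)\<^sup>2) * ((cos \<theta>)\<^sup>2 + (sin \<theta>)\<^sup>2)"
      unfolding norm_2_sq f_def by (simp add: q1) (use sin_cos_squared_add[of \<theta>] in algebra)
    then show ?thesis using qq by simp
  qed
  then have "norm (f \<theta>) = 1" by (smt (verit) norm_ge_zero power2_eq_1_iff)
  moreover have "cross2 q (f \<theta>) = sin \<theta> * ((q $ 1)\<^sup>2 + (q $ 2)\<^sup>2)"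
    unfolding cross2_def f_def by (simp add: q1) algebra
  moreover have "sin \<theta> > 0" using th pi_gt3 by (intro sin_gt_zero) auto
  ultimately show ?thesis
    using q qK qq by (intro that[of q "f \<theta>"]) (auto simp: K_Cone)
qed

text \<open>Two independent directions outside the cone control a whole word at once: their preimages under
  \<open>T w\<close> stay outside the cone, hence uniformly transversal to it, and at least one of them is
  stretched by at most a multiple of \<open>a2 w\<close>.\<close>

lemma cone_expansion:
  obtains c where "0 < c" "c \<le> 1"
    "\<And>w v. v \<in> Cone \<Longrightarrow> c * a1 w * norm v \<le> norm (T w *v v)"
proof -
  obtain \<epsilon> where \<epsilon>: "\<epsilon> > 0"
    "\<And>v p i. v \<in> Cone \<Longrightarrow> p \<notin> Cone \<Longrightarrow>
       \<epsilon> * norm (transpose (A i) *v v) * norm p \<le> \<bar>cross2 (transpose (A i) *v v) p\<bar>"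
    using uniform_transversality by blast
  obtain q q' where q: "norm q = 1" "norm q' = 1" "q \<notin> Cone" "q' \<notin> Cone" "cross2 q q' \<noteq> 0"
    using basis_outside_Cone by blast
  define \<eta> where "\<eta> = \<bar>cross2 q q'\<bar>"
  have \<eta>: "\<eta> > 0" using q by (simp add: \<eta>_def)
  \<comment> \<open>Transversality is available only for vectors that have already passed one
    letter, so the bound is first proved for these.\<close>
  have step: "\<epsilon> * \<eta> / 2 * a1 w * norm x \<le> norm (T w *v x)"
    if x: "x = transpose (A i) *v v" and v: "v \<in> Cone" for x v i w
  proof -
    have dT: "det (T w) \<noteq> 0" using det_word by simp
    then obtain W where W: "T w ** W = mat 1" "W ** T w = mat 1"
      by (metis invertible_det_nz invertible_def)
    define p where "p = W *v q"
    define p' where "p' = W *v q'"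
    have Tp: "T w *v p = q" "T w *v p' = q'"
      by (simp_all add: p_def p'_def matrix_vector_mul_assoc W)
    \<comment> \<open>An area estimate: \<open>T w\<close> multiplies the area of \<open>x\<close>
      and \<open>y\<close> by its determinant, and the image of \<open>y\<close> has length
      1.\<close>
    have est: "\<bar>det (T w)\<bar> * (\<epsilon> * norm x * norm y) \<le> norm (T w *v x)"
      if y: "norm (T w *v y) = 1" "T w *v y \<notin> Cone" for y
    proof -
      have "y \<notin> Cone" using y Cone_T by auto
      then have "\<epsilon> * norm x * norm y \<le> \<bar>cross2 x y\<bar>" unfolding x by (rule \<epsilon>(2)[OF v])
      then have "\<bar>det (T w)\<bar> * (\<epsilon> * norm x * norm y) \<le> \<bar>cross2 (T w *v x) (T w *v y)\<bar>"
        unfolding cross2_mult abs_mult by (rule mult_left_mono) simp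
      also have "\<dots> \<le> norm (T w *v x)" using abs_cross2_le[of "T w *v x" "T w *v y"] y by simp
      finally show ?thesis .
    qed
    \<comment> \<open>A unit vector contracted the most. Expanding it in \<open>p\<close> and
      \<open>p'\<close> will show that these preimages cannot both be shorter than a multiple of 1 /
      \<open>a2 w\<close>.\<close>
    obtain u where u: "norm u = 1" "norm (T w *v u) = alpha2 (T w)"
      by (rule singular_vectors[of "T w"])
    define z where "z = T w *v u"
    \<comment> \<open>Coefficients in the basis \<open>q\<close>, \<open>q'\<close> by Cramer's
      rule.\<close>
    define a where "a = cross2 z q' / cross2 q q'"
    define b where "b = cross2 q z / cross2 q q'"
    have "cross2 q q' *\<^sub>R z = cross2 z q' *\<^sub>R q + cross2 q z *\<^sub>R q'"
      by (simp add: vec_eq_2 cross2_def algebra_simps)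
    then have "(1 / cross2 q q') *\<^sub>R (cross2 q q' *\<^sub>R z) =
        (1 / cross2 q q') *\<^sub>R (cross2 z q' *\<^sub>R q + cross2 q z *\<^sub>R q')"
      by (rule arg_cong)
    then have "z = a *\<^sub>R q + b *\<^sub>R q'"
      using q(5) by (simp add: a_def b_def scaleR_add_right)
    then have "T w *v u = T w *v (a *\<^sub>R p + b *\<^sub>R p')"
      by (simp add: z_def matrix_vector_right_distrib matrix_vector_mult_scaleR Tp)
    then have ueq: "u = a *\<^sub>R p + b *\<^sub>R p'"
      by (metis W(2) matrix_vector_mul_assoc matrix_vector_mul_lid)
    have nz: "norm z = a2 w" using u(2) alpha2_transpose[OF det_word] by (simp add: z_def)
    have ab: "\<bar>a\<bar> \<le> a2 w / \<eta>" "\<bar>b\<bar> \<le> a2 w / \<eta>"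
      using abs_cross2_le[of z q'] abs_cross2_le[of q z] q nz \<eta>
      by (auto simp: a_def b_def \<eta>_def intro!: divide_right_mono)
    have "1 \<le> \<bar>a\<bar> * norm p + \<bar>b\<bar> * norm p'"
      using u(1) ueq norm_triangle_ineq[of "a *\<^sub>R p" "b *\<^sub>R p'"] by simp
    also have "\<dots> \<le> a2 w / \<eta> * norm p + a2 w / \<eta> * norm p'"
      by (intro add_mono mult_right_mono ab) auto
    finally have one: "\<eta> \<le> a2 w * (norm p + norm p')"
      using \<eta> by (simp add: field_simps)
    \<comment> \<open>The factor \<open>a2 w\<close> supplied by \<open>one\<close> completes
      \<open>a1 w\<close> to the determinant, and the two area estimates can be added.\<close>
    have d: "\<bar>det (T w)\<bar> = a1 w * a2 w" using alpha_det[of "mat_word A w"] by simp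
    have "\<epsilon> * \<eta> * a1 w * norm x \<le> \<epsilon> * a1 w * norm x * (a2 w * (norm p + norm p'))"
      using mult_left_mono[OF one, of "\<epsilon> * a1 w * norm x"] \<epsilon>(1) a_pos[of w] by (simp add: mult_ac)
    also have "\<dots> = \<bar>det (T w)\<bar> * (\<epsilon> * norm x * norm p) + \<bar>det (T w)\<bar> * (\<epsilon> * norm x * norm p')"
      unfolding d by (simp add: algebra_simps)
    also have "\<dots> \<le> 2 * norm (T w *v x)"
      using est[of p] est[of p'] Tp q by simp
    finally show ?thesis by simp
  qed
  \<comment> \<open>The minimum with 1 serves the empty word; \<kappa> pays for the first letter of
    a nonempty one.\<close>
  define c where "c = min 1 (\<epsilon> * \<eta> / 2 * \<kappa>)"
  have c1: "0 < c" "c \<le> 1" using \<epsilon>(1) \<eta> kappa_pos by (auto simp: c_def)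
  show ?thesis
  proof (rule that[OF c1])
    fix w v assume v: "v \<in> Cone"
    show "c * a1 w * norm v \<le> norm (T w *v v)"
    proof (cases w)
      case Nil
      then show ?thesis using c1 by (simp add: transpose_mat alpha_one mult_left_le_one_le)
    next
      case (Cons i u)
      have "c * a1 w \<le> \<epsilon> * \<eta> / 2 * \<kappa> * a1 u"
      proof (rule mult_mono)
        have "a1 w \<le> alpha1 (A i) * a1 u" by (simp add: Cons alpha1_mult_le)
        also have "\<dots> \<le> 1 * a1 u"
          by (intro mult_right_mono alpha1_lt_1[THEN less_imp_le]) (simp add: a_pos less_imp_le)
        finally show "a1 w \<le> a1 u" by simp
      qed (use \<epsilon>(1) \<eta> kappa_pos a_pos[of w] in \<open>auto simp: c_def\<close>)
      then have "c * a1 w * norm v \<le> \<epsilon> * \<eta> / 2 * \<kappa> * a1 u * norm v"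
        by (rule mult_right_mono) simp
      also have "\<dots> = \<epsilon> * \<eta> / 2 * a1 u * (\<kappa> * norm v)" by simp
      also have "\<dots> \<le> \<epsilon> * \<eta> / 2 * a1 u * norm (transpose (A i) *v v)"
      proof (rule mult_left_mono)
        have "\<kappa> * norm v \<le> alpha2 (transpose (A i)) * norm v"
          using kappa_le[of i] alpha2_transpose[OF detA, of i] by (simp add: mult_right_mono)
        also have "\<dots> \<le> norm (transpose (A i) *v v)" by (rule alpha2_le_norm_mult)
        finally show "\<kappa> * norm v \<le> norm (transpose (A i) *v v)" .
        show "0 \<le> \<epsilon> * \<eta> / 2 * a1 u" using \<epsilon>(1) \<eta> a_pos[of u] by simp
      qed
      also have "\<dots> \<le> norm (T u *v (transpose (A i) *v v))" by (rule step[OF refl v])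
      finally show ?thesis by (simp add: Cons T_Cons[symmetric] del: mat_word_simps)
    qed
  qed
qed

end

section \<open>Hausdorff measure and coverings\<close>

lemma hausdorff_pre_antimono: "\<delta> \<le> \<delta>' \<Longrightarrow> hausdorff_pre s \<delta>' E \<le> hausdorff_pre s \<delta> E"
  unfolding hausdorff_pre_def by (intro INF_superset_mono) (auto intro: less_le_trans)

text \<open>A smaller mesh admits fewer covers, so the premeasure is monotone and its one-sided
  limit is a supremum.\<close>

lemma hausdorff_eq_SUP: "hausdorff s E = (SUP \<delta>\<in>{0<..}. hausdorff_pre s \<delta> E)"
  unfolding hausdorff_def
proof (rule tendsto_Lim)
  show "((\<lambda>\<delta>. hausdorff_pre s \<delta> E) \<longlongrightarrow> (SUP \<delta>\<in>{0<..}. hausdorff_pre s \<delta> E)) (at_right 0)"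
  proof (rule order_tendstoI)
    fix a assume "a < (SUP \<delta>\<in>{0<..}. hausdorff_pre s \<delta> E)"
    then obtain d where d: "d > 0" "a < hausdorff_pre s d E" by (auto simp: less_SUP_iff)
    show "\<forall>\<^sub>F \<delta> in at_right 0. a < hausdorff_pre s \<delta> E"
      unfolding eventually_at_right_field
    proof (intro exI[of _ d] conjI allI impI)
      fix \<delta> assume "0 < \<delta>" "\<delta> < d"
      then show "a < hausdorff_pre s \<delta> E"
        using d(2) hausdorff_pre_antimono[of \<delta> d s E] by (meson less_imp_le less_le_trans)
    qed (use d in auto)
  next
    fix a assume a: "(SUP \<delta>\<in>{0<..}. hausdorff_pre s \<delta> E) < a"
    show "\<forall>\<^sub>F \<delta> in at_right 0. hausdorff_pre s \<delta> E < a"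
      using eventually_at_right_less[of "0 :: real"]
    proof eventually_elim
      case (elim \<delta>)
      then have "hausdorff_pre s \<delta> E \<le> (SUP \<delta>\<in>{0<..}. hausdorff_pre s \<delta> E)" by (intro SUP_upper) simp
      then show ?case using a by (rule le_less_trans)
    qed
  qed
qed simp

section \<open>Finite covers and the mass distribution principle\<close>

text \<open>No mesh bound is imposed: for positive \<open>s\<close> a small total cost already
  forces small diameters. Finite families fit a construction that subdivides into finitely many
  cylinders.\<close>

definition fincover :: "real \<Rightarrow> (real^2) set \<Rightarrow> real \<Rightarrow> bool" where
  "fincover s E b \<longleftrightarrow>
     (\<exists>F. finite F \<and> (\<forall>U\<in>F. bounded U) \<and> E \<subseteq> \<Union>F \<and> (\<Sum>U\<in>F. diameter U powr s) \<le> b)"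

lemma fincover_mono: "fincover s E b \<Longrightarrow> E' \<subseteq> E \<Longrightarrow> b \<le> b' \<Longrightarrow> fincover s E' b'"
  unfolding fincover_def by (meson order_trans)

lemma fincover_empty: "fincover s {} 0"
  unfolding fincover_def by (intro exI[of _ "{}"]) auto

lemma fincover_Un:
  assumes "fincover s E b" "fincover s E' b'"
  shows "fincover s (E \<union> E') (b + b')"
proof -
  obtain F where F: "finite F" "\<forall>U\<in>F. bounded U" "E \<subseteq> \<Union>F" "(\<Sum>U\<in>F. diameter U powr s) \<le> b"
    using assms(1) by (auto simp: fincover_def)
  obtain F' where F': "finite F'" "\<forall>U\<in>F'. bounded U" "E' \<subseteq> \<Union>F'" "(\<Sum>U\<in>F'. diameter U powr s) \<le> b'"
    using assms(2) by (auto simp: fincover_def)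
  have "(\<Sum>U\<in>F \<union> F'. diameter U powr s) \<le> (\<Sum>U\<in>F. diameter U powr s) + (\<Sum>U\<in>F'. diameter U powr s)"
    using sum.union_inter[OF F(1) F'(1), of "\<lambda>U. diameter U powr s"]
      sum_nonneg[of "F \<inter> F'" "\<lambda>U. diameter U powr s"] by auto
  then show ?thesis unfolding fincover_def
    by (intro exI[of _ "F \<union> F'"]) (use F F' in auto)
qed

lemma fincover_UN:
  assumes "finite I" "\<And>i. i \<in> I \<Longrightarrow> fincover s (E i) (b i)"
  shows "fincover s (\<Union>i\<in>I. E i) (\<Sum>i\<in>I. b i)"
  using assms by (induction I) (auto intro: fincover_empty fincover_Un)

lemma hausdorff_eq_0:
  assumes s: "0 < s" and cov: "\<And>e. e > 0 \<Longrightarrow> fincover s E e"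
  shows "hausdorff s E = 0"
proof -
  have *: "hausdorff_pre s \<delta> E \<le> ennreal e" if \<delta>: "\<delta> > 0" and e: "0 < e" for \<delta> e
  proof -
    \<comment> \<open>One set costs no more than the total, so a total of at most
      \<open>(\<delta> / 2) powr s\<close> keeps every diameter below \<delta>.\<close>
    define e' where "e' = min e ((\<delta> / 2) powr s)"
    have "fincover s E e'" using \<delta> e by (intro cov) (auto simp: e'_def)
    then obtain F where F: "finite F" "\<forall>U\<in>F. bounded U" "E \<subseteq> \<Union>F" "(\<Sum>U\<in>F. diameter U powr s) \<le> e'"
      by (auto simp: fincover_def)
    obtain f where f: "bij_betw f {..<card F} F"
      using ex_bij_betw_nat_finite[OF F(1)] by (auto simp: atLeast0LessThan)
    \<comment> \<open>The finite family is padded with empty sets, which have diameter 0 and cost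
      \<open>0 powr s = 0\<close>.\<close>
    define U where "U i = (if i < card F then f i else {})" for i
    have "diameter V < \<delta>" if "V \<in> F" for V
    proof -
      have "diameter V powr s \<le> (\<Sum>U\<in>F. diameter U powr s)" by (rule member_le_sum[OF that]) (auto simp: F)
      then have "diameter V powr s < \<delta> powr s"
        using F(4) \<delta> s powr_less_mono2[of s "\<delta> / 2" \<delta>] by (simp add: e'_def)
      then show ?thesis using s \<delta> powr_mono2[of s \<delta> "diameter V"] by (meson less_imp_le not_le)
    qed
    moreover have UF: "i < card F \<Longrightarrow> U i \<in> F" for i using f by (auto simp: U_def bij_betw_def)
    ultimately have U: "bounded (U i)" "diameter (U i) < \<delta>" for i
      using F(2) \<delta> by (cases "i < card F"; auto simp: U_def)+
    have "E \<subseteq> (\<Union>i. U i)"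
    proof
      fix x assume "x \<in> E"
      then obtain V where "V \<in> F" "x \<in> V" using F by auto
      then show "x \<in> (\<Union>i. U i)" using f by (auto simp: U_def bij_betw_def)
    qed
    then have "hausdorff_pre s \<delta> E \<le> (\<Sum>i. ennreal (diameter (U i) powr s))"
      unfolding hausdorff_pre_def using U by (intro INF_lower) auto
    also have "\<dots> = (\<Sum>i<card F. ennreal (diameter (U i) powr s))"
      by (rule suminf_finite) (auto simp: U_def)
    also have "\<dots> = ennreal (\<Sum>i<card F. diameter (U i) powr s)" by (rule sum_ennreal) simp
    also have "(\<Sum>i<card F. diameter (U i) powr s) = (\<Sum>V\<in>F. diameter V powr s)"
      by (rule sum.reindex_bij_betw[OF f, THEN trans[rotated]]) (auto simp: U_def)
    also have "ennreal \<dots> \<le> ennreal e" using F(4) by (intro ennreal_leI) (simp add: e'_def)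
    finally show ?thesis .
  qed
  have "hausdorff_pre s \<delta> E = 0" if "\<delta> > 0" for \<delta>
  proof -
    have "hausdorff_pre s \<delta> E \<le> 0" by (rule ennreal_le_epsilon) (simp add: * that)
    then show ?thesis by simp
  qed
  then show ?thesis by (simp add: hausdorff_eq_SUP)
qed

text \<open>Each covering set lies in a disc about one of its points, so its mass is at most
  \<open>c\<close> times its cost. Total mass 1 bounds the cost of every cover from below by 1 /
  \<open>c\<close>.\<close>

lemma mass_distribution_principle:
  assumes "prob_space \<mu>" and g: "g \<in> borel_measurable \<mu>" and gE: "\<And>\<omega>. \<omega> \<in> space \<mu> \<Longrightarrow> g \<omega> \<in> E"
    and s: "0 < s" and c: "0 < c"
    and le: "\<And>x r. 0 < r \<Longrightarrow> measure \<mu> (g -` ball x r \<inter> space \<mu>) \<le> c * r powr s"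
  shows "hausdorff s E > 0"
proof -
  interpret prob_space \<mu> by fact
  have "ennreal (1 / c) \<le> hausdorff_pre s 1 E"
    unfolding hausdorff_pre_def
  proof (rule INF_greatest)
    fix U assume "U \<in> {U :: nat \<Rightarrow> (real^2) set. E \<subseteq> (\<Union>i. U i) \<and> (\<forall>i. bounded (U i) \<and> diameter (U i) < 1)}"
    then have U: "E \<subseteq> (\<Union>i. U i)" "\<And>i. bounded (U i)" by auto
    \<comment> \<open>Covering sets need not be measurable; their closures are, and fit into the
      same closed discs.\<close>
    define N where "N i = g -` closure (U i) \<inter> space \<mu>" for i
    have N: "N i \<in> sets \<mu>" for i unfolding N_def by (rule measurable_sets[OF g]) auto
    have le': "emeasure \<mu> (N i) \<le> ennreal (c * diameter (U i) powr s)" for i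
    proof (cases "U i = {}")
      case False
      then obtain x where x: "x \<in> U i" by auto
      define d where "d = diameter (U i)"
      \<comment> \<open>The hypothesis concerns open discs of positive radius, so the radius is
        enlarged by \<open>e\<close>, which then tends to 0. This includes sets of diameter
        0.\<close>
      have "measure \<mu> (N i) \<le> c * (d + e) powr s" if e: "e > 0" for e
      proof -
        have "dist x y \<le> d" if "y \<in> U i" for y
          unfolding d_def using diameter_bounded_bound[OF U(2) x that] .
        then have "closure (U i) \<subseteq> cball x d" by (intro closure_minimal) auto
        then have "N i \<subseteq> g -` ball x (d + e) \<inter> space \<mu>" using e by (auto simp: N_def)
        then have "measure \<mu> (N i) \<le> measure \<mu> (g -` ball x (d + e) \<inter> space \<mu>)"
          by (intro finite_measure_mono measurable_sets[OF g]) auto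
        also have "\<dots> \<le> c * (d + e) powr s"
          using e diameter_ge_0[OF U(2), of i] by (intro le) (auto simp: d_def)
        finally show ?thesis .
      qed
      moreover have "((\<lambda>e. c * (d + e) powr s) \<longlongrightarrow> c * (d + 0) powr s) (at_right 0)"
        using s diameter_ge_0[OF U(2), of i]
        by (intro tendsto_intros tendsto_powr') (auto simp: d_def eventually_at_right_field intro!: exI[of _ 1])
      ultimately have "measure \<mu> (N i) \<le> c * (d + 0) powr s"
        by (intro tendsto_lowerbound[of _ _ "at_right (0::real)"])
           (auto simp: eventually_at_right_field intro!: exI[of _ 1])
      then show ?thesis by (simp add: emeasure_eq_measure d_def ennreal_leI)
    qed (simp add: N_def)
    have "1 = emeasure \<mu> (space \<mu>)" by (simp add: emeasure_space_1)
    also have "\<dots> \<le> emeasure \<mu> (\<Union>i. N i)"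
    proof (rule emeasure_mono)
      show "space \<mu> \<subseteq> (\<Union>i. N i)"
      proof
        fix \<omega> assume w: "\<omega> \<in> space \<mu>"
        then obtain i where "g \<omega> \<in> U i" using gE U(1) by blast
        then show "\<omega> \<in> (\<Union>i. N i)" using w closure_subset[of "U i"] by (auto simp: N_def)
      qed
    qed (use N in auto)
    also have "\<dots> \<le> (\<Sum>i. emeasure \<mu> (N i))"
      by (rule emeasure_subadditive_countably) (use N in auto)
    also have "\<dots> \<le> (\<Sum>i. ennreal c * ennreal (diameter (U i) powr s))"
      using le' c by (intro suminf_le) (auto simp: ennreal_mult)
    also have "\<dots> = ennreal c * (\<Sum>i. ennreal (diameter (U i) powr s))" by simp
    finally have "ennreal (1 / c) * 1 \<le> ennreal (1 / c) * (ennreal c * (\<Sum>i. ennreal (diameter (U i) powr s)))"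
      by (rule mult_left_mono) simp
    also have "\<dots> = (\<Sum>i. ennreal (diameter (U i) powr s))"
      using c by (simp add: mult.assoc[symmetric] ennreal_mult[symmetric])
    finally show "ennreal (1 / c) \<le> (\<Sum>i. ennreal (diameter (U i) powr s))" by simp
  qed
  also have "\<dots> \<le> hausdorff s E" unfolding hausdorff_eq_SUP by (rule SUP_upper) simp
  finally show ?thesis using c by (auto intro: less_le_trans[rotated])
qed

lemma orth_proj_span:
  assumes "norm v = 1"
  shows "orth_proj (span {v}) x = (x \<bullet> v) *\<^sub>R v"
  unfolding orth_proj_def
proof (rule the_equality)
  have vv: "v \<bullet> v = 1" using assms by (simp flip: power2_norm_eq_inner)
  show "(x \<bullet> v) *\<^sub>R v \<in> span {v} \<and> (\<forall>w\<in>span {v}. orthogonal (x - (x \<bullet> v) *\<^sub>R v) w)"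
    by (auto simp: span_singleton orthogonal_def inner_diff_left vv)
  fix y assume "y \<in> span {v} \<and> (\<forall>w\<in>span {v}. orthogonal (x - y) w)"
  then obtain k where "y = k *\<^sub>R v" "(x - y) \<bullet> v = 0"
    by (auto simp: span_singleton orthogonal_def)
  then show "y = (x \<bullet> v) *\<^sub>R v" using vv by (simp add: inner_diff_left)
qed

text \<open>The image of a disc of radius \<open>\<rho>\<close> is an ellipse with semi-axes \<open>\<rho> \<alpha>\<^sub>1\<close>, \<open>\<rho> \<alpha>\<^sub>2\<close>; cut it across the
  long axis into about \<open>\<alpha>\<^sub>1 / \<alpha>\<^sub>2\<close> pieces of diameter comparable to \<open>\<rho> \<alpha>\<^sub>2\<close>.\<close>

lemma fincover_affine_image:
  assumes f: "\<And>y y'. f y - f y' = M *v (y - y')" and M: "det M \<noteq> 0"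
    and G: "G \<subseteq> cball x \<rho>" and \<rho>: "0 < \<rho>" and s: "1 < s" "s \<le> 2"
  shows "fincover s (f ` G) (27 * (alpha1 M * alpha2 M powr (s - 1)) * \<rho> powr s)"
proof (rule singular_vectors[of M])
  fix v1 assume v1: "norm v1 = 1"
    and v: "\<And>z. norm (M *v z) \<le> alpha1 M * \<bar>z \<bullet> v1\<bar> + alpha2 M * norm z"
  define a where "a = alpha1 M"
  define b where "b = alpha2 M"
  have ab: "0 < b" "b \<le> a" "0 < a" using alpha_pos[OF M] alpha_nonneg[of M] by (auto simp: a_def b_def)
  \<comment> \<open>Slices of this thickness are stretched to length \<open>\<rho> * b\<close> along
    the long axis, matching the short axis.\<close>
  define h where "h = \<rho> * b / a"
  have h: "0 < h" using ab \<rho> by (simp add: h_def)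
  \<comment> \<open>The width \<open>2 * \<rho>\<close> of the disc amounts to
    \<open>2 * a / b\<close> slices.\<close>
  define N where "N = nat \<lfloor>2 * a / b\<rfloor>"
  define P where "P k = {y \<in> G. real k * h \<le> (y - x) \<bullet> v1 + \<rho> \<and> (y - x) \<bullet> v1 + \<rho> \<le> (real k + 1) * h}" for k :: nat
  have in_ball: "norm (y - x) \<le> \<rho>" if "y \<in> G" for y
    using G that by (auto simp: dist_norm norm_minus_commute)
  have cov: "G \<subseteq> (\<Union>k\<in>{..N}. P k)"
  proof
    fix y assume y: "y \<in> G"
    define c where "c = (y - x) \<bullet> v1 + \<rho>"
    have "\<bar>(y - x) \<bullet> v1\<bar> \<le> \<rho>"
      using Cauchy_Schwarz_ineq2[of "y - x" v1] in_ball[OF y] v1 by simp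
    then have c: "0 \<le> c" "c \<le> 2 * \<rho>" by (auto simp: c_def)
    define k where "k = nat \<lfloor>c / h\<rfloor>"
    have k: "real k \<le> c / h" "c / h \<le> real k + 1"
      using c h unfolding k_def by (auto simp: of_nat_floor)
    have "c / h \<le> 2 * a / b"
      using c ab \<rho> by (simp add: h_def field_simps)
    then have "k \<le> N" unfolding k_def N_def by (intro nat_mono floor_mono)
    moreover have "y \<in> P k" using y k h unfolding P_def c_def[symmetric] by (simp add: field_simps c_def)
    ultimately show "y \<in> (\<Union>k\<in>{..N}. P k)" by auto
  qed
  have diam: "norm (f y - f y') \<le> 3 * \<rho> * b" if y: "y \<in> P k" "y' \<in> P k" for y y' k
  proof -
    have "\<bar>(y - y') \<bullet> v1\<bar> \<le> h"
      using y unfolding P_def by (auto simp: inner_diff_left algebra_simps abs_le_iff)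
    moreover have "norm (y - y') \<le> 2 * \<rho>"
      using y in_ball[of y] in_ball[of y'] norm_triangle_ineq4[of "y - x" "y' - x"] by (auto simp: P_def)
    ultimately have "a * \<bar>(y - y') \<bullet> v1\<bar> + b * norm (y - y') \<le> a * h + b * (2 * \<rho>)"
      using ab by (intro add_mono mult_left_mono) auto
    also have "\<dots> = 3 * \<rho> * b" using ab by (simp add: h_def)
    finally show ?thesis using v[of "y - y'"] f by (simp add: a_def b_def)
  qed
  have one: "fincover s (f ` P k) ((3 * \<rho> * b) powr s)" for k
    unfolding fincover_def
  proof (intro exI[of _ "{f ` P k}"] conjI)
    show "\<forall>U\<in>{f ` P k}. bounded U"
    proof (cases "P k = {}")
      case False
      then obtain y where "y \<in> P k" by auto
      then have "f ` P k \<subseteq> cball (f y) (3 * \<rho> * b)" using diam by (auto simp: dist_norm)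
      then show ?thesis using bounded_subset[OF bounded_cball] by auto
    qed auto
    have "diameter (f ` P k) \<le> 3 * \<rho> * b"
      using diam \<rho> ab by (intro diameter_le) auto
    then show "(\<Sum>U\<in>{f ` P k}. diameter U powr s) \<le> (3 * \<rho> * b) powr s"
      using s \<open>\<forall>U\<in>{f ` P k}. bounded U\<close> by (simp add: powr_mono2 diameter_ge_0)
  qed auto
  have "fincover s (\<Union>k\<in>{..N}. f ` P k) (\<Sum>k\<in>{..N}. (3 * \<rho> * b) powr s)"
    by (rule fincover_UN) (use one in auto)
  moreover have "f ` G \<subseteq> (\<Union>k\<in>{..N}. f ` P k)" using cov by blast
  moreover have "(\<Sum>k\<in>{..N}. (3 * \<rho> * b) powr s) \<le> 27 * (a * b powr (s - 1)) * \<rho> powr s"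
  proof -
    have "real N \<le> 2 * a / b" unfolding N_def using ab by (intro of_nat_floor) auto
    \<comment> \<open>The extra slice is absorbed by \<open>b \<le> a\<close>.\<close>
    then have N: "real N + 1 \<le> 3 * a / b" using ab by (simp add: field_simps)
    have "(\<Sum>k\<in>{..N}. (3 * \<rho> * b) powr s) = (real N + 1) * (3 * \<rho> * b) powr s" by simp
    also have "\<dots> \<le> 3 * a / b * (3 * \<rho> * b) powr s" by (rule mult_right_mono[OF N]) simp
    also have "\<dots> = 3 * 3 powr s * (a * (b powr s / b)) * \<rho> powr s"
      using \<rho> ab by (simp add: powr_mult)
    also have "b powr s / b = b powr (s - 1)" using ab by (simp add: powr_diff)
    also have "3 * 3 powr s * (a * b powr (s - 1)) * \<rho> powr s \<le> 27 * (a * b powr (s - 1)) * \<rho> powr s"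
    proof -
      \<comment> \<open>The constant 27 is \<open>3 * 3 powr 2\<close>.\<close>
      have "(3::real) powr s \<le> 3 powr 2" using s by (intro powr_mono) auto
      then show ?thesis using ab by (intro mult_right_mono) auto
    qed
    finally show ?thesis .
  qed
  ultimately show ?thesis unfolding a_def b_def by (rule fincover_mono)
qed

section \<open>Cylinders, Furstenberg directions and the quasi-Bernoulli property\<close>

lemma mem_cylinder: "x \<in> cylinder w \<longleftrightarrow> (\<forall>i<length w. x i = w ! i)"
proof -
  have "word_prefix (length w) x = w \<longleftrightarrow>
      length (word_prefix (length w) x) = length w \<and> (\<forall>i<length w. word_prefix (length w) x ! i = w ! i)"
    by (metis nth_equalityI)
  then show ?thesis by (simp add: cylinder_def word_prefix_def)
qed

lemma length_word_prefix [simp]: "length (word_prefix n x) = n"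
  by (simp add: word_prefix_def)

lemma word_prefix_Suc: "word_prefix (Suc n) x = word_prefix n x @ [x n]"
  by (simp add: word_prefix_def)

lemma mem_cylinder_prefix: "x \<in> cylinder (word_prefix n x)"
  by (simp add: cylinder_def)

lemma cylinder_append_subset: "cylinder (u @ v) \<subseteq> cylinder u"
  by (auto simp: mem_cylinder nth_append split: if_splits)

lemma cylinder_append_ex:
  assumes "x \<in> cylinder u"
  shows "\<exists>v. length v = n \<and> x \<in> cylinder (u @ v)"
proof (intro exI conjI)
  show "x \<in> cylinder (u @ map (\<lambda>i. x (length u + i)) [0..<n])"
    unfolding mem_cylinder
  proof (intro allI impI)
    fix i assume i: "i < length (u @ map (\<lambda>i. x (length u + i)) [0..<n])"
    show "x i = (u @ map (\<lambda>i. x (length u + i)) [0..<n]) ! i"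
    proof (cases "i < length u")
      case False
      then obtain j where "i = length u + j" using le_Suc_ex not_less by blast
      then show ?thesis using i by simp
    qed (use assms in \<open>simp add: mem_cylinder nth_append\<close>)
  qed
qed simp

lemma cylinder_append_eq:
  assumes "x \<in> cylinder (u @ v)" "x \<in> cylinder (u @ v')" "length v = length v'"
  shows "v = v'"
  using assms by (simp add: cylinder_def)

lemma cylinder_sets: "cylinder w \<in> sets (word_borel :: (nat \<Rightarrow> 'a::finite) measure)"
proof -
  have "openin (product_topology (\<lambda>_. discrete_topology UNIV) UNIV)
      (\<Pi>\<^sub>E i\<in>UNIV. if i < length w then {w ! i} else (UNIV :: 'a set))"
    by (rule product_topology_basis) (auto intro: finite_subset[of _ "{..<length w}"])
  also have "(\<Pi>\<^sub>E i\<in>UNIV. if i < length w then {w ! i} else UNIV) = cylinder w"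
    by (rule set_eqI) (simp add: mem_cylinder PiE_iff)
  finally show ?thesis unfolding word_borel_def by (intro in_measure_of) auto
qed

lemma sgn_mult_sgn: "sgn (M *v (sgn y)) = sgn (M *v y)" for y :: "real^2" and M :: "real^2^2"
  by (cases "y = 0") (auto simp: sgn_div_norm matrix_vector_mult_scaleR)

section \<open>Furstenberg directions and almost multiplicativity of norms\<close>

context multicone
begin

lemma Cone_sgn: "v \<in> Cone \<Longrightarrow> sgn v \<in> K"
  using Cone_scale[of v "inverse (norm v)"] by (auto simp: K_Cone sgn_div_norm Cone_def)

lemma span_sgn: "v \<noteq> 0 \<Longrightarrow> span {sgn v} = span {v :: real^2}"
  by (simp add: sgn_div_norm span_singleton_scale)

lemma mem_C: "V \<in> \<C> \<longleftrightarrow> (\<exists>v\<in>Cone. V = span {v})"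
proof
  assume V: "V \<in> \<C>"
  then obtain v where v: "norm v = 1" "V = span {v}" using rp1_E C_rp1(1) by (metis subsetD)
  then have "v \<in> Cone" using V by (auto simp: Cone_def)
  then show "\<exists>v\<in>Cone. V = span {v}" using v by blast
qed (auto simp: Cone_def)

lemma adj_word_rev: "adj_word A (rev w) = T w"
proof (induction w)
  case Nil
  show ?case by (simp add: adj_word_def transpose_mat)
next
  case (Cons i w)
  have "adj_word A (rev (i # w)) = adj_word A (rev w) ** transpose (A i)"
    by (simp add: adj_word_def mat_word_append)
  then show ?case unfolding Cons.IH by (simp add: matrix_transpose_mul)
qed

text \<open>Reversal permutes the words of a given length, so the product of transposes in word
  order may be traded for the transpose \<open>T w\<close> of the word's matrix.\<close>

lemma mem_furstenberg:
  "V \<in> furstenberg_dirs A \<C> \<longleftrightarrow> (\<forall>n. \<exists>w v. length w = n \<and> v \<in> Cone \<and> V = span {T w *v v})"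
proof -
  have "(\<exists>w\<in>{w. length w = n}. V \<in> rp1_act (adj_word A w) ` \<C>) \<longleftrightarrow>
      (\<exists>w v. length w = n \<and> v \<in> Cone \<and> V = span {T w *v v})" for n
  proof
    assume "\<exists>w\<in>{w. length w = n}. V \<in> rp1_act (adj_word A w) ` \<C>"
    then obtain w v where "length w = n" "v \<in> Cone" "V = span {adj_word A w *v v}"
      unfolding image_iff Bex_def mem_C by (auto simp: rp1_act_span)
    then show "\<exists>w v. length w = n \<and> v \<in> Cone \<and> V = span {T w *v v}"
      by (intro exI[of _ "rev w"] exI[of _ v]) (simp flip: adj_word_rev)
  next
    assume "\<exists>w v. length w = n \<and> v \<in> Cone \<and> V = span {T w *v v}"
    then obtain w v where "length w = n" "v \<in> Cone" "V = span {T w *v v}" by blast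
    then show "\<exists>w\<in>{w. length w = n}. V \<in> rp1_act (adj_word A w) ` \<C>"
      by (intro bexI[of _ "rev w"] image_eqI[of _ _ "span {v}"])
         (auto simp: rp1_act_span adj_word_rev mem_C)
  qed
  then show ?thesis by (auto simp: furstenberg_dirs_def)
qed

lemma furstenberg_E:
  assumes "V \<in> furstenberg_dirs A \<C>"
  obtains v where "v \<in> K" "V = span {v}"
proof -
  obtain v where v: "v \<in> Cone" "V = span {v}"
    using assms unfolding mem_furstenberg by (metis length_0_conv mat_word_simps(1) matrix_vector_mul_lid transpose_mat)
  then show ?thesis using that[of "sgn v"] Cone_sgn span_sgn by (auto simp: Cone_def)
qed

text \<open>Appending a letter gives a word of length n + 1. Its first letter acts first and can be
  absorbed into the cone vector, which restores length n.\<close>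

lemma furstenberg_step:
  assumes "span {v} \<in> furstenberg_dirs A \<C>"
  shows "span {transpose (A i) *v v} \<in> furstenberg_dirs A \<C>"
  unfolding mem_furstenberg
proof
  fix n
  obtain w u where w: "length w = n" "u \<in> Cone" "span {v} = span {T w *v u}"
    using assms unfolding mem_furstenberg by blast
  have e: "span {transpose (A i) *v v} = span {T (w @ [i]) *v u}"
    unfolding T_snoc rp1_act_span[symmetric] w(3) ..
  obtain j w' where j: "w @ [i] = j # w'" by (cases "w @ [i]") auto
  then have "length w' = n" using w(1) by (metis length_Cons length_append_singleton nat.inject)
  moreover have "span {transpose (A i) *v v} = span {T w' *v (transpose (A j) *v u)}"
    unfolding e j T_Cons ..
  ultimately show "\<exists>w u. length w = n \<and> u \<in> Cone \<and> span {transpose (A i) *v v} = span {T w *v u}"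
    using Cone_step(1)[OF w(2)] by blast
qed

lemma furstenberg_T:
  assumes "span {v} \<in> furstenberg_dirs A \<C>"
  shows "span {T w *v v} \<in> furstenberg_dirs A \<C>"
proof (induction w rule: rev_induct)
  case (snoc i w)
  then show ?case unfolding T_snoc by (rule furstenberg_step)
qed (use assms in \<open>simp add: transpose_mat\<close>)

lemma Cone_ex: "\<exists>v. v \<in> K"
proof -
  obtain v where "v \<in> Cone" using mem_C C_rp1(2) by blast
  then show ?thesis using Cone_sgn by blast
qed

text \<open>Cantor's intersection theorem on the circle: the normalised images of \<open>K\<close>
  under words of length n are compact and nonempty, and they decrease because the first letter maps
  the cone into itself.\<close>

lemma furstenberg_nonempty: "\<exists>v\<in>K. span {v} \<in> furstenberg_dirs A \<C>"
proof -
  define S where "S n = (\<Union>w\<in>{w. length w = n}. (\<lambda>v. sgn (T w *v v)) ` K)" for n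
  have nz: "T w *v v \<noteq> 0" if "v \<in> Cone" for v w
    using Cone_T[OF that] by (auto simp: Cone_def)
  have "compact (S n)" for n
    unfolding S_def
    by (intro compact_UN compact_continuous_image finite_lists_length_eq[of UNIV, simplified] compact_K
        continuous_on_sgn linear_continuous_on matrix_vector_mul_bounded_linear)
       (auto simp: K_Cone nz)
  moreover have "S n \<noteq> {}" for n
  proof -
    have "replicate n undefined \<in> {w :: 'a list. length w = n}" by simp
    then show ?thesis using Cone_ex unfolding S_def by blast
  qed
  moreover have "S n \<subseteq> S m" if "m \<le> n" for m n
    using that
  proof (rule lift_Suc_antimono_le[rotated])
    fix n show "S (Suc n) \<subseteq> S n"
    proof
      fix x assume "x \<in> S (Suc n)"
      then obtain w v where w: "length w = Suc n" "v \<in> K" "x = sgn (T w *v v)" by (auto simp: S_def)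
      then obtain j w' where j: "w = j # w'" by (cases w) auto
      have "x = sgn (T w' *v sgn (transpose (A j) *v v))"
        unfolding w j T_Cons sgn_mult_sgn ..
      moreover have "sgn (transpose (A j) *v v) \<in> K" using w by (intro Cone_sgn Cone_step) (simp add: K_Cone)
      ultimately show "x \<in> S n" using w j unfolding S_def by auto
    qed
  qed
  ultimately have "\<Inter>(range S) \<noteq> {}" by (intro compact_nest)
  then obtain x where x: "\<And>n. x \<in> S n" by auto
  have "x \<in> K" using x[of 0] by (auto simp: S_def transpose_mat K_Cone sgn_div_norm)
  moreover have "span {x} \<in> furstenberg_dirs A \<C>"
    unfolding mem_furstenberg
  proof
    fix n
    obtain w v where "length w = n" "v \<in> K" "x = sgn (T w *v v)" using x[of n] by (auto simp: S_def)
    then show "\<exists>w v. length w = n \<and> v \<in> Cone \<and> span {x} = span {T w *v v}"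
      using nz[of v w] by (intro exI[of _ w] exI[of _ v]) (auto simp: K_Cone span_sgn)
  qed
  ultimately show ?thesis by blast
qed

text \<open>A vector of the cone is expanded almost maximally by \<open>T u\<close>, stays in the
  cone, and is then expanded almost maximally by \<open>T v\<close>.\<close>

lemma a1_mult_ge:
  obtains k where "0 < k" "k \<le> 1" "\<And>u v. k * a1 u * a1 v \<le> a1 (u @ v)"
proof -
  obtain c where c: "0 < c" "c \<le> 1" "\<And>w v. v \<in> Cone \<Longrightarrow> c * a1 w * norm v \<le> norm (T w *v v)"
    using cone_expansion by blast
  obtain x where x: "x \<in> K" using Cone_ex by blast
  show ?thesis
  proof (rule that[of "c * c"])
    show "0 < c * c" "c * c \<le> 1" using c by (auto intro: mult_le_one)
    fix u v
    have "c * c * a1 u * a1 v = c * a1 v * (c * a1 u * norm x)" using x by (simp add: K_Cone)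
    also have "\<dots> \<le> c * a1 v * norm (T u *v x)"
      using x c a_pos[of v] by (intro mult_left_mono c(3)) (auto simp: K_Cone)
    also have "\<dots> \<le> norm (T v *v (T u *v x))"
      by (rule c(3)) (use Cone_T x K_Cone in auto)
    also have "\<dots> = norm (T (u @ v) *v x)"
      by (simp add: mat_word_append matrix_transpose_mul matrix_vector_mul_assoc)
    also have "\<dots> \<le> alpha1 (T (u @ v)) * norm x" by (rule norm_mult_le_alpha1)
    also have "\<dots> = a1 (u @ v)" using x by (simp add: alpha1_transpose K_Cone)
    finally show "c * c * a1 u * a1 v \<le> a1 (u @ v)" .
  qed
qed

lemma a2_eq: "a2 w = \<bar>det (mat_word A w)\<bar> / a1 w"
  using alpha_det[of "mat_word A w"] a_pos[of w] by (simp add: field_simps)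

end

section \<open>Gibbs bounds on cylinders\<close>

locale kaenmaki_system = multicone A t \<C>
  for A :: "'a::finite \<Rightarrow> real^2^2" and t \<C> +
  fixes X :: "(real^2) set" and \<mu> :: "(nat \<Rightarrow> 'a) measure" and s c\<^sub>K :: real
  assumes attr: "is_attractor A t X"
    and s: "1 < s" "s \<le> 2"
    and sets_\<mu>: "sets \<mu> = sets word_borel"
    and prob: "prob_space \<mu>"
    and c\<^sub>K: "0 < c\<^sub>K"
    and gibbs: "\<And>w. inverse c\<^sub>K * sv_fun s (mat_word A w) \<le> measure \<mu> (cylinder w)"
      "\<And>w. measure \<mu> (cylinder w) \<le> c\<^sub>K * sv_fun s (mat_word A w)"
begin

sublocale prob_space \<mu> by (rule prob)

abbreviation m :: "'a list \<Rightarrow> real" where "m w \<equiv> measure \<mu> (cylinder w)"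
definition \<phi> :: "'a list \<Rightarrow> real" where "\<phi> w = a1 w * a2 w powr (s - 1)"
abbreviation \<pi> :: "(nat \<Rightarrow> 'a) \<Rightarrow> real^2" where "\<pi> \<equiv> natural_proj A t"
abbreviation f :: "'a list \<Rightarrow> real^2 \<Rightarrow> real^2" where "f \<equiv> aff_word A t"
definition d :: real where "d = diameter X"

lemma phi_pos: "0 < \<phi> w" by (simp add: \<phi>_def a_pos order_less_imp_not_eq2)

lemma gibbs_phi: "\<phi> w \<le> c\<^sub>K * m w" "m w \<le> c\<^sub>K * \<phi> w"
  using gibbs[of w] c\<^sub>K s by (auto simp: sv_fun_def \<phi>_def field_simps)

lemma m_pos: "0 < m w" using gibbs_phi(1)[of w] phi_pos[of w] c\<^sub>K by (smt (verit) mult_nonneg_nonpos)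

text \<open>The determinant factor is multiplicative, so products only require estimates of
  \<open>a1\<close>, which enters with the nonnegative exponent 2 - s.\<close>

lemma phi_eq: "\<phi> w = a1 w powr (2 - s) * \<bar>det (mat_word A w)\<bar> powr (s - 1)"
proof -
  have "\<bar>det (mat_word A w)\<bar> powr (s - 1) = a1 w powr (s - 1) * a2 w powr (s - 1)"
    unfolding alpha_det[symmetric] using a_pos[of w] by (simp add: powr_mult)
  moreover have "a1 w powr (2 - s) * a1 w powr (s - 1) = a1 w"
    using a_pos(1)[of w] by (simp flip: powr_add)
  ultimately show ?thesis by (simp add: \<phi>_def mult.assoc[symmetric])
qed

lemma det_append: "\<bar>det (mat_word A (u @ v))\<bar> = \<bar>det (mat_word A u)\<bar> * \<bar>det (mat_word A v)\<bar>"
  by (simp add: mat_word_append det_mul abs_mult)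

lemma phi_mult_le: "\<phi> (u @ v) \<le> \<phi> u * \<phi> v"
proof -
  have "a1 (u @ v) powr (2 - s) \<le> (a1 u * a1 v) powr (2 - s)"
    using s a_pos[of "u @ v"] by (intro powr_mono2) (auto simp: mat_word_append alpha1_mult_le)
  then show ?thesis
    using mult_right_mono[of "a1 (u @ v) powr (2 - s)" "(a1 u * a1 v) powr (2 - s)"
        "(\<bar>det (mat_word A u)\<bar> * \<bar>det (mat_word A v)\<bar>) powr (s - 1)"]
    unfolding phi_eq det_append using a_pos[of u] a_pos[of v] by (simp add: powr_mult mult_ac)
qed

text \<open>Submultiplicativity and almost supermultiplicativity of \<phi> pass to the measure
  through the Gibbs bounds, with one factor \<open>c\<^sub>K\<close> for each of the three
  cylinders.\<close>

lemma quasi_bernoulli: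
  "\<exists>Q>0. (\<forall>u v. m (u @ v) \<le> Q * m u * m v) \<and> (\<forall>u v. m u * m v \<le> Q * m (u @ v))"
proof -
  obtain k where k: "0 < k" "k \<le> 1" "\<And>u v. k * a1 u * a1 v \<le> a1 (u @ v)" using a1_mult_ge by blast
  have phi_mult_ge: "k * (\<phi> u * \<phi> v) \<le> \<phi> (u @ v)" for u v
  proof -
    \<comment> \<open>For \<open>k \<le> 1\<close> and an exponent 2 - s in [0, 1) one has
      \<open>k \<le> k powr (2 - s)\<close>.\<close>
    have "k * (a1 u powr (2 - s) * a1 v powr (2 - s)) \<le> k powr (2 - s) * (a1 u powr (2 - s) * a1 v powr (2 - s))"
      using powr_mono'[of "2 - s" 1 k] k s by (intro mult_right_mono) auto
    also have "\<dots> = (k * a1 u * a1 v) powr (2 - s)"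
      using k a_pos[of u] a_pos[of v] by (simp add: powr_mult)
    also have "\<dots> \<le> a1 (u @ v) powr (2 - s)"
      using s k a_pos[of u] a_pos[of v] by (intro powr_mono2 k(3)) auto
    finally have "k * (a1 u powr (2 - s) * a1 v powr (2 - s)) \<le> a1 (u @ v) powr (2 - s)" .
    then show ?thesis
      using mult_right_mono[of "k * (a1 u powr (2 - s) * a1 v powr (2 - s))" "a1 (u @ v) powr (2 - s)"
          "(\<bar>det (mat_word A u)\<bar> * \<bar>det (mat_word A v)\<bar>) powr (s - 1)"]
      unfolding phi_eq det_append by (simp add: powr_mult mult_ac)
  qed
  have le: "m (u @ v) \<le> c\<^sub>K ^ 3 * m u * m v" for u v
  proof -
    have "m (u @ v) \<le> c\<^sub>K * (\<phi> u * \<phi> v)"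
      by (rule order_trans[OF gibbs_phi(2)]) (use c\<^sub>K in \<open>simp add: phi_mult_le\<close>)
    also have "\<dots> \<le> c\<^sub>K * ((c\<^sub>K * m u) * (c\<^sub>K * m v))"
      using c\<^sub>K phi_pos by (intro mult_left_mono mult_mono gibbs_phi) (auto simp: less_imp_le)
    finally show ?thesis by (simp add: power3_eq_cube mult_ac)
  qed
  have ge: "k * (m u * m v) \<le> c\<^sub>K ^ 3 * m (u @ v)" for u v
  proof -
    have "k * (m u * m v) \<le> k * ((c\<^sub>K * \<phi> u) * (c\<^sub>K * \<phi> v))"
      using c\<^sub>K k phi_pos by (intro mult_left_mono mult_mono gibbs_phi) (auto simp: less_imp_le)
    also have "\<dots> = c\<^sub>K\<^sup>2 * (k * (\<phi> u * \<phi> v))" by (simp add: power2_eq_square)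
    also have "\<dots> \<le> c\<^sub>K\<^sup>2 * (c\<^sub>K * m (u @ v))"
      using phi_mult_ge[of u v] gibbs_phi(1)[of "u @ v"] by (intro mult_left_mono) auto
    finally show ?thesis by (simp add: power3_eq_cube power2_eq_square mult_ac)
  qed
  show ?thesis
  proof (intro exI[of _ "c\<^sub>K ^ 3 / k"] conjI allI)
    show "0 < c\<^sub>K ^ 3 / k" using c\<^sub>K k by simp
    fix u v
    have "c\<^sub>K ^ 3 * m u * m v \<le> c\<^sub>K ^ 3 / k * m u * m v"
      using k c\<^sub>K by (intro mult_right_mono) (auto simp: field_simps)
    with le[of u v] show "m (u @ v) \<le> c\<^sub>K ^ 3 / k * m u * m v" by linarith
    show "m u * m v \<le> c\<^sub>K ^ 3 / k * m (u @ v)" using ge[of u v] k by (simp add: field_simps)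
  qed
qed

section \<open>Cylinder masses, the attractor and the natural projection\<close>

lemma finite_words: "finite {v :: 'a list. length v = n}"
  using finite_lists_length_eq[of "UNIV :: 'a set" n] by simp

lemma cylinder_in_sets [measurable]: "cylinder w \<in> sets \<mu>"
  by (simp add: sets_\<mu> cylinder_sets)

lemma space_\<mu>: "space \<mu> = UNIV"
  using sets_eq_imp_space_eq[OF sets_\<mu>] by (simp add: word_borel_def)

lemma measure_cylinders:
  assumes "J \<subseteq> {v. length v = n}"
  shows "measure \<mu> (\<Union>v\<in>J. cylinder (u @ v)) = (\<Sum>v\<in>J. m (u @ v))"
proof (rule finite_measure_finite_Union)
  show "finite J" using assms finite_words by (rule finite_subset)
  show "disjoint_family_on (\<lambda>v. cylinder (u @ v)) J"
    unfolding disjoint_family_on_def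
    using assms cylinder_append_eq by blast
qed auto

lemma measure_cylinders_all: "(\<Sum>v\<in>{v. length v = n}. m (u @ v)) = m u"
proof -
  have "(\<Union>v\<in>{v. length v = n}. cylinder (u @ v)) = cylinder u"
    using cylinder_append_subset cylinder_append_ex by (fastforce simp del: append_assoc)
  then show ?thesis using measure_cylinders[of "{v. length v = n}" n u] by simp
qed

lemma compact_X: "compact X" and X_nonempty: "X \<noteq> {}" and X_eq: "X = (\<Union>i. aff A t i ` X)"
  using attr by (auto simp: is_attractor_def)

lemma dist_X: "x \<in> X \<Longrightarrow> y \<in> X \<Longrightarrow> dist x y \<le> d"
  unfolding d_def by (intro diameter_bounded_bound compact_imp_bounded compact_X)

lemma d_nonneg: "0 \<le> d"
  unfolding d_def by (intro diameter_ge_0 compact_imp_bounded compact_X)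

lemma f_X: "f w ` X \<subseteq> X"
proof (induction w)
  case (Cons i w)
  then show ?case using X_eq by auto
qed auto

lemma f_append_X: "f (u @ v) ` X \<subseteq> f u ` X"
  using f_X[of v] by (auto simp: aff_word_append)

lemma X_eq_words: "X = (\<Union>v\<in>{v. length v = n}. f v ` X)"
proof (induction n)
  case (Suc n)
  have "X = (\<Union>i. aff A t i ` (\<Union>v\<in>{v. length v = n}. f v ` X))"
    using X_eq Suc.IH by simp
  also have "\<dots> = (\<Union>v\<in>{v. length v = Suc n}. f v ` X)"
  proof (intro set_eqI iffI)
    fix x assume "x \<in> (\<Union>i. aff A t i ` (\<Union>v\<in>{v. length v = n}. f v ` X))"
    then obtain i v y where "length v = n" "y \<in> X" "x = f (i # v) y" by auto
    then show "x \<in> (\<Union>v\<in>{v. length v = Suc n}. f v ` X)"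
      by (intro UN_I[of "i # v"]) auto
  next
    fix x assume "x \<in> (\<Union>v\<in>{v. length v = Suc n}. f v ` X)"
    then obtain v y where v: "length v = Suc n" "y \<in> X" "x = f v y" by auto
    then obtain i w where "v = i # w" by (cases v) auto
    then show "x \<in> (\<Union>i. aff A t i ` (\<Union>v\<in>{v. length v = n}. f v ` X))"
      using v by auto
  qed
  finally show ?case .
qed auto

lemma dist_f_X:
  assumes "x \<in> f w ` X" "y \<in> f w ` X"
  shows "dist x y \<le> a1 w * d"
proof -
  obtain x' y' where xy: "x' \<in> X" "y' \<in> X" "x = f w x'" "y = f w y'" using assms by auto
  have "dist x y \<le> a1 w * dist x' y'" unfolding xy by (rule dist_aff_word_le)
  also have "\<dots> \<le> a1 w * d" using dist_X[OF xy(1,2)] a_pos(1)[of w] by simp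
  finally show ?thesis .
qed

lemma a1_d_small:
  assumes "0 < e"
  obtains n where "\<And>w. length w \<ge> n \<Longrightarrow> a1 w * d < e"
proof -
  \<comment> \<open>Dividing by \<open>d + 1\<close> also covers a one-point attractor.\<close>
  obtain n where n: "\<And>w. length w \<ge> n \<Longrightarrow> a1 w < e / (d + 1)"
    using a1_small[of "e / (d + 1)"] assms d_nonneg by auto
  have "a1 w * d < e" if "length w \<ge> n" for w
  proof -
    have "a1 w * (d + 1) < e" using n[OF that] d_nonneg by (simp add: field_simps)
    then show ?thesis using a_pos[of w] by (simp add: algebra_simps)
  qed
  then show ?thesis using that by blast
qed

text \<open>The compact images of X along the prefixes are nested and share a point. Contraction
  draws the images of every starting point \<open>a\<close> to it, so it is the limit in the
  definition; the freedom in \<open>a\<close> later allows points of the open set U.\<close>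

lemma f_tendsto: "(\<lambda>n. f (word_prefix n x) a) \<longlonglongrightarrow> \<pi> x"
  and natural_proj_mem_prefix: "\<pi> x \<in> f (word_prefix n x) ` X"
proof -
  define S where "S n = f (word_prefix n x) ` X" for n
  have cont: "continuous_on X (f w)" for w
  proof -
    have "f w = (\<lambda>x. mat_word A w *v x + f w 0)"
    proof
      show "f w x = mat_word A w *v x + f w 0" for x
        using aff_word_diff[of A t w x 0] by (simp only: diff_eq_eq diff_0_right)
    qed
    then show ?thesis
      by (rule ssubst[where P = "continuous_on X"])
         (intro continuous_intros linear_continuous_on matrix_vector_mul_bounded_linear)
  qed
  have "compact (S n)" for n
    unfolding S_def by (intro compact_continuous_image compact_X cont)
  moreover have "S n \<noteq> {}" for n using X_nonempty by (simp add: S_def)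
  moreover have "S n \<subseteq> S k" if "k \<le> n" for k n
    using that by (rule lift_Suc_antimono_le[rotated]) (simp add: S_def word_prefix_Suc f_append_X)
  ultimately have "\<Inter>(range S) \<noteq> {}" by (intro compact_nest)
  then obtain z where z: "\<And>n. z \<in> S n" by auto
  have tends: "(\<lambda>n. f (word_prefix n x) a) \<longlonglongrightarrow> z" for a
  proof -
    obtain R where R: "\<And>b. b \<in> X \<Longrightarrow> dist a b \<le> R"
      using compact_imp_bounded[OF compact_X] bounded_any_center[of X a] by auto
    have "dist (f (word_prefix n x) a) z \<le> \<Lambda> ^ n * R" for n
    proof -
      obtain b where b: "b \<in> X" "z = f (word_prefix n x) b" using z[of n] by (auto simp: S_def)
      have "dist (f (word_prefix n x) a) z \<le> a1 (word_prefix n x) * dist a b"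
        unfolding b by (rule dist_aff_word_le)
      also have "\<dots> \<le> \<Lambda> ^ n * R"
        using a1_le[of "word_prefix n x"] R[OF b(1)] Lambda(1) by (intro mult_mono) auto
      finally show ?thesis .
    qed
    moreover have lim: "(\<lambda>n. \<Lambda> ^ n * R) \<longlonglongrightarrow> 0"
      using Lambda(1,2) by (intro tendsto_mult_left_zero LIMSEQ_power_zero) auto
    ultimately have "(\<lambda>n. dist (f (word_prefix n x) a) z) \<longlonglongrightarrow> 0"
      by (intro Lim_null_comparison[OF always_eventually lim]) auto
    then show ?thesis by (rule tendsto_dist_iff[THEN iffD2])
  qed
  have "\<pi> x = z" unfolding natural_proj_def by (rule limI[OF tends])
  then show "(\<lambda>n. f (word_prefix n x) a) \<longlonglongrightarrow> \<pi> x" "\<pi> x \<in> f (word_prefix n x) ` X"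
    using tends z by (auto simp: S_def)
qed

lemma natural_proj_mem: "x \<in> cylinder w \<Longrightarrow> \<pi> x \<in> f w ` X"
  using natural_proj_mem_prefix[of x "length w"] by (simp add: cylinder_def)

lemma natural_proj_X: "\<pi> x \<in> X"
  using natural_proj_mem[of x "[]"] by (auto simp: mem_cylinder)

text \<open>The preimage of an open set is the union of the cylinders it contains, and there are
  only countably many words.\<close>

lemma natural_proj_measurable [measurable]: "\<pi> \<in> borel_measurable \<mu>"
proof (rule borel_measurableI)
  fix S :: "(real^2) set" assume S: "open S"
  have "\<pi> -` S = (\<Union>w\<in>{w. cylinder w \<subseteq> \<pi> -` S}. cylinder w)"
  proof (intro set_eqI iffI)
    fix x assume "x \<in> \<pi> -` S"
    then obtain e where e: "e > 0" "ball (\<pi> x) e \<subseteq> S" using S by (auto simp: open_contains_ball)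
    obtain n where n: "\<And>w. length w \<ge> n \<Longrightarrow> a1 w * d < e" using a1_d_small[OF e(1)] by blast
    have "cylinder (word_prefix n x) \<subseteq> \<pi> -` S"
    proof
      fix y assume "y \<in> cylinder (word_prefix n x)"
      then have "dist (\<pi> x) (\<pi> y) \<le> a1 (word_prefix n x) * d"
        by (intro dist_f_X natural_proj_mem mem_cylinder_prefix)
      also have "\<dots> < e" by (rule n) simp
      finally show "y \<in> \<pi> -` S" using e(2) by auto
    qed
    then show "x \<in> (\<Union>w\<in>{w. cylinder w \<subseteq> \<pi> -` S}. cylinder w)" using mem_cylinder_prefix by blast
  qed auto
  moreover have "(\<Union>w\<in>{w. cylinder w \<subseteq> \<pi> -` S}. cylinder w) \<in> sets \<mu>"
    by (intro sets.countable_UN'') auto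
  ultimately show "\<pi> -` S \<inter> space \<mu> \<in> sets \<mu>" by (simp add: space_\<mu>)
qed

text \<open>In the coordinate given by the unit vector \<open>v\<close>, a ball in the line pulls
  back to a strip orthogonal to \<open>v\<close>.\<close>

lemma proj_measure_ball:
  assumes v: "norm v = 1"
  shows "measure (proj_measure A t \<mu> (span {v})) (span {v} \<inter> ball (\<tau> *\<^sub>R v) r) =
    measure \<mu> {x. \<bar>\<pi> x \<bullet> v - \<tau>\<bar> < r}"
proof -
  define V where "V = span {v}"
  have op: "orth_proj V = (\<lambda>x. (x \<bullet> v) *\<^sub>R v)" unfolding V_def using orth_proj_span[OF v] by auto
  have meas: "orth_proj V \<in> borel \<rightarrow>\<^sub>M restrict_space borel V"
    unfolding op by (rule measurable_restrict_space2) (auto simp: V_def span_base span_mul)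
  have set: "V \<inter> ball (\<tau> *\<^sub>R v) r \<in> sets (restrict_space borel V)"
    by (auto simp: sets_restrict_space)
  have "measure (proj_measure A t \<mu> V) (V \<inter> ball (\<tau> *\<^sub>R v) r) =
     measure \<mu> (\<pi> -` (orth_proj V -` (V \<inter> ball (\<tau> *\<^sub>R v) r) \<inter> space borel) \<inter> space \<mu>)"
    unfolding proj_measure_def
    by (subst measure_distr) (use meas set measurable_sets[OF meas set] in \<open>auto simp: measure_distr\<close>)
  also have "\<pi> -` (orth_proj V -` (V \<inter> ball (\<tau> *\<^sub>R v) r) \<inter> space borel) \<inter> space \<mu> =
      {x. \<bar>\<pi> x \<bullet> v - \<tau>\<bar> < r}"
    by (auto simp: orth_proj_span[OF v] V_def span_base span_mul space_\<mu> v abs_minus_commute)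
  finally show ?thesis by (simp add: V_def)
qed

text \<open>Condition (2) expressed by strips in the plane, with unit vectors in place of lines and
  points of X in place of their projections.\<close>

definition lipschitz_projections :: "real \<Rightarrow> bool" where
  "lipschitz_projections C \<longleftrightarrow>
     (\<forall>v\<in>K. span {v} \<in> furstenberg_dirs A \<C> \<longrightarrow>
        (\<forall>p\<in>X. \<forall>r>0. measure \<mu> {x. \<bar>(\<pi> x - p) \<bullet> v\<bar> < r} \<le> C * r))"

lemma lipschitz_projections_iff:
  "lipschitz_projections C \<longleftrightarrow>
     (\<forall>V \<in> furstenberg_dirs A \<C>. \<forall>p \<in> orth_proj V ` X. \<forall>r>0.
         measure (proj_measure A t \<mu> V) (V \<inter> ball p r) \<le> C * r)" (is "_ \<longleftrightarrow> ?R")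
proof
  assume L: "lipschitz_projections C"
  show ?R
  proof (intro ballI allI impI)
    fix V p and r :: real assume V: "V \<in> furstenberg_dirs A \<C>" and p: "p \<in> orth_proj V ` X" and r: "r > 0"
    obtain v where v: "v \<in> K" "V = span {v}" using V by (rule furstenberg_E)
    then have n: "norm v = 1" by (simp add: K_Cone)
    obtain q where q: "q \<in> X" "p = (q \<bullet> v) *\<^sub>R v" using p v orth_proj_span[OF n] by auto
    show "measure (proj_measure A t \<mu> V) (V \<inter> ball p r) \<le> C * r"
      using L v V q r unfolding lipschitz_projections_def
      by (simp add: proj_measure_ball[OF n] inner_diff_left)
  qed
next
  assume R: ?R
  show "lipschitz_projections C"
    unfolding lipschitz_projections_def
  proof (intro ballI allI impI)
    fix v p and r :: real assume v: "v \<in> K" "span {v} \<in> furstenberg_dirs A \<C>" and p: "p \<in> X" and r: "r > 0"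
    have n: "norm v = 1" using v by (simp add: K_Cone)
    have "(p \<bullet> v) *\<^sub>R v \<in> orth_proj (span {v}) ` X" using p orth_proj_span[OF n, of p] by (metis imageI)
    then have "measure (proj_measure A t \<mu> (span {v})) (span {v} \<inter> ball ((p \<bullet> v) *\<^sub>R v) r) \<le> C * r"
      using R v r by blast
    then show "measure \<mu> {x. \<bar>(\<pi> x - p) \<bullet> v\<bar> < r} \<le> C * r"
      by (simp add: proj_measure_ball[OF n] inner_diff_left)
  qed
qed

end

section \<open>The two implications\<close>

text \<open>The vector \<open>M *v z\<close> is resolved along \<open>z0\<close> and its quarter
  turn. The first component is \<gamma> times \<open>z \<bullet> v\<close>; the second pairs
  \<open>z\<close> with a vector \<open>q\<close> whose part orthogonal to \<open>v\<close> is fixed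
  by the determinant. Hence a strip orthogonal to \<open>v\<close> is squeezed in both
  directions.\<close>

lemma norm_mult_strip:
  assumes n: "norm z0 = 1" "norm v = 1" and T: "transpose M *v z0 = \<gamma> *\<^sub>R v" and \<gamma>: "\<gamma> \<noteq> 0"
  shows "norm (M *v z) \<le> 2 * alpha1 M * \<bar>z \<bullet> v\<bar> + \<bar>det M\<bar> / \<bar>\<gamma>\<bar> * norm z"
proof -
  define J :: "real^2 \<Rightarrow> real^2" where "J x = vector [- x $ 2, x $ 1]" for x
  have J: "J x $ 1 = - x $ 2" "J x $ 2 = x $ 1" for x by (simp_all add: J_def)
  have normJ: "norm (J x) = norm x" for x
    by (rule power2_eq_imp_eq) (simp_all add: norm_2_sq J)
  have crossJ: "cross2 x y = y \<bullet> J x" for x y by (simp add: cross2_def inner_2 J)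
  have orth: "x \<bullet> J x = 0" for x by (simp add: inner_2 J)
  have decomp: "(y \<bullet> x)\<^sup>2 + (y \<bullet> J x)\<^sup>2 = (norm y)\<^sup>2" if "norm x = 1" for x y
    using orthonormal_2_norm[of x "J x" y] that by (simp add: normJ orth)
  define q where "q = transpose M *v J z0"
  have q: "norm q \<le> alpha1 M"
    using norm_mult_le_alpha1[of "transpose M" "J z0"] n by (simp add: q_def alpha1_transpose normJ)
  have \<gamma>a: "\<bar>\<gamma>\<bar> \<le> alpha1 M"
    using norm_mult_le_alpha1[of "transpose M" z0] n by (simp add: T alpha1_transpose)
  \<comment> \<open>Comparing areas before and after the transpose yields the component of
    \<open>q\<close> orthogonal to \<open>v\<close>.\<close>
  have "det M * cross2 z0 (J z0) = \<gamma> * cross2 v q"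
    using cross2_mult[of "transpose M" z0 "J z0"] unfolding T q_def[symmetric]
    by (simp add: cross2_def algebra_simps)
  moreover have "cross2 z0 (J z0) = 1"
    using n norm_2_sq[of z0] by (simp add: cross2_def J power2_eq_square)
  ultimately have "\<bar>det M\<bar> = \<bar>\<gamma>\<bar> * \<bar>q \<bullet> J v\<bar>" unfolding crossJ[of v q] by (simp add: abs_mult)
  then have qJ: "\<bar>q \<bullet> J v\<bar> = \<bar>det M\<bar> / \<bar>\<gamma>\<bar>" using \<gamma> by simp
  have zq: "z \<bullet> q = (z \<bullet> v) * (q \<bullet> v) + (z \<bullet> J v) * (q \<bullet> J v)"
  proof -
    have "(v $ 1)\<^sup>2 + (v $ 2)\<^sup>2 = 1" using n norm_2_sq[of v] by simp
    then show ?thesis unfolding inner_2 J by algebra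
  qed
  have "\<bar>z \<bullet> q\<bar> \<le> \<bar>z \<bullet> v\<bar> * \<bar>q \<bullet> v\<bar> + \<bar>z \<bullet> J v\<bar> * \<bar>q \<bullet> J v\<bar>"
    unfolding zq by (metis abs_mult abs_triangle_ineq)
  also have "\<dots> \<le> \<bar>z \<bullet> v\<bar> * alpha1 M + norm z * (\<bar>det M\<bar> / \<bar>\<gamma>\<bar>)"
    unfolding qJ
    using Cauchy_Schwarz_ineq2[of q v] Cauchy_Schwarz_ineq2[of z "J v"] n q
    by (intro add_mono mult_left_mono mult_right_mono) (auto simp: normJ)
  finally have 1: "\<bar>z \<bullet> q\<bar> \<le> alpha1 M * \<bar>z \<bullet> v\<bar> + \<bar>det M\<bar> / \<bar>\<gamma>\<bar> * norm z"
    by (simp add: mult.commute)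
  have "\<bar>z \<bullet> (\<gamma> *\<^sub>R v)\<bar> = \<bar>\<gamma>\<bar> * \<bar>z \<bullet> v\<bar>" by (simp add: abs_mult)
  also have "\<dots> \<le> alpha1 M * \<bar>z \<bullet> v\<bar>" using \<gamma>a by (intro mult_right_mono) auto
  finally have 2: "\<bar>z \<bullet> (\<gamma> *\<^sub>R v)\<bar> \<le> alpha1 M * \<bar>z \<bullet> v\<bar>" .
  have "norm (M *v z) \<le> \<bar>(M *v z) \<bullet> z0\<bar> + \<bar>(M *v z) \<bullet> J z0\<bar>"
  proof (rule power2_le_imp_le)
    show "(norm (M *v z))\<^sup>2 \<le> (\<bar>(M *v z) \<bullet> z0\<bar> + \<bar>(M *v z) \<bullet> J z0\<bar>)\<^sup>2"
      unfolding decomp[OF n(1), symmetric] by (simp add: power2_sum)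
  qed simp
  also have "\<dots> = \<bar>z \<bullet> (\<gamma> *\<^sub>R v)\<bar> + \<bar>z \<bullet> q\<bar>" by (simp only: inner_transpose T q_def)
  finally show ?thesis using 1 2 by simp
qed

context multicone
begin

lemma unit_span_mult:
  assumes "norm v = 1" "span {v} = span {x}"
  obtains \<gamma> where "x = \<gamma> *\<^sub>R v" "\<bar>\<gamma>\<bar> = norm x"
proof -
  have "x \<in> span {v}" using assms(2) by (simp add: span_base)
  then obtain \<gamma> where "x = \<gamma> *\<^sub>R v" by (auto simp: span_singleton)
  then show ?thesis using assms(1) by (intro that[of \<gamma>]) auto
qed

text \<open>Letters are removed from the front while \<open>a2 \<le> r * a1\<close> persists. At the
  last such suffix the reverse inequality fails by at most the factor \<kappa>; the empty word is
  excluded by \<open>r < 1\<close>. Suffixes are the right choice because the removed prefix acts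
  first under \<open>T\<close>.\<close>

lemma stopping_suffix:
  assumes "r < 1" "0 < r" "a2 w' \<le> r * a1 w'"
  shows "\<exists>u w. w' = u @ w \<and> a2 w \<le> r * a1 w \<and> \<kappa> * (r * a1 w) \<le> a2 w"
  using assms(3)
proof (induction w')
  case Nil
  then show ?case using assms by (simp add: alpha_one)
next
  case (Cons i w)
  show ?case
  proof (cases "a2 w \<le> r * a1 w")
    case True
    then obtain u w1 where "w = u @ w1" "a2 w1 \<le> r * a1 w1" "\<kappa> * (r * a1 w1) \<le> a2 w1"
      using Cons.IH by blast
    then show ?thesis by (intro exI[of _ "i # u"] exI[of _ w1]) auto
  next
    case False
    have "a1 (i # w) \<le> alpha1 (A i) * a1 w" by (simp add: alpha1_mult_le)
    also have "\<dots> \<le> 1 * a1 w"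
      using alpha1_lt_1[of i] a_pos(1)[of w] by (intro mult_right_mono) auto
    finally have "\<kappa> * (r * a1 (i # w)) \<le> \<kappa> * (r * a1 w)"
      using kappa_pos assms by (intro mult_left_mono) auto
    also have "\<dots> \<le> \<kappa> * a2 w" using False kappa_pos by (intro mult_left_mono) auto
    also have "\<dots> \<le> alpha2 (A i) * a2 w"
      using kappa_le[of i] a_pos(2)[of w] by (intro mult_right_mono) auto
    also have "\<dots> \<le> a2 (i # w)" by (simp add: alpha2_mult_ge)
    finally show ?thesis using Cons.prems by (intro exI[of _ "[]"] exI[of _ "i # w"]) simp
  qed
qed

end

section \<open>From bounded projections to positive Hausdorff measure\<close>

context kaenmaki_system
begin

text \<open>Every strip about a one-point attractor has mass 1, which contradicts the bound at
  radius 1 / (2 C). Hence \<open>d\<close> may be taken positive when stopping words are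
  used.\<close>

lemma no_lipschitz_singleton:
  assumes "d = 0" "0 < C"
  shows "\<not> lipschitz_projections C"
proof
  assume L: "lipschitz_projections C"
  obtain v where v: "v \<in> K" "span {v} \<in> furstenberg_dirs A \<C>" using furstenberg_nonempty by blast
  obtain p where p: "p \<in> X" using X_nonempty by auto
  have pos: "0 < 1 / (2 * C)" using assms by simp
  have "\<pi> x = p" for x using dist_X[OF natural_proj_X p, of x] assms by simp
  then have "{x. \<bar>(\<pi> x - p) \<bullet> v\<bar> < 1 / (2 * C)} = space \<mu>" using assms by (simp add: space_\<mu>)
  moreover have "measure \<mu> {x. \<bar>(\<pi> x - p) \<bullet> v\<bar> < 1 / (2 * C)} \<le> C * (1 / (2 * C))"
    using L v p pos unfolding lipschitz_projections_def by blast
  ultimately show False using prob_space assms by simp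
qed

lemma measurable_strip: "{x. \<bar>(\<pi> x - p) \<bullet> v\<bar> < r} \<in> sets \<mu>"
proof -
  have "{x \<in> space \<mu>. \<bar>(\<pi> x - p) \<bullet> v\<bar> < r} \<in> sets \<mu>" by measurable
  then show ?thesis by (simp add: space_\<mu>)
qed

lemma sum_measure_cylinders:
  assumes "J \<subseteq> {v. length v = n}"
  shows "(\<Sum>v\<in>J. m v) = measure \<mu> (\<Union>v\<in>J. cylinder v)"
  using measure_cylinders[OF assms, of "[]"] by simp

text \<open>The preimage of a disc of radius \<open>r\<close> under \<open>f w\<close> meets \<open>X\<close> in a strip of width comparable to
  \<open>r / a1 w\<close> orthogonal to any Furstenberg direction \<open>span {T w *v v0}\<close>. The strip is covered by
  cylinders, so that only the Gibbs property on cylinders is needed.\<close>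

lemma cylinder_ball_measure:
  assumes L: "lipschitz_projections C" and C: "0 < C"
  obtains c where "0 < c"
    "\<And>w x r. 0 < r \<Longrightarrow> measure \<mu> (cylinder w \<inter> \<pi> -` ball x r) \<le> c * a2 w powr (s - 1) * r"
proof -
  obtain Q where Q: "0 < Q" "\<And>u v. m (u @ v) \<le> Q * m u * m v"
    using quasi_bernoulli by blast
  obtain c0 where c0: "0 < c0" "c0 \<le> 1" "\<And>w v. v \<in> Cone \<Longrightarrow> c0 * a1 w * norm v \<le> norm (T w *v v)"
    using cone_expansion by blast
  obtain v0 where v0: "v0 \<in> K" "span {v0} \<in> furstenberg_dirs A \<C>" using furstenberg_nonempty by blast
  define c where "c = Q * c\<^sub>K * C * 3 / c0"
  have bound: "measure \<mu> (cylinder w \<inter> \<pi> -` ball x r) \<le> c * a2 w powr (s - 1) * r" if r: "0 < r" for w x r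
  proof -
    define y0 where "y0 = T w *v v0"
    define v where "v = sgn y0"
    have y0: "y0 \<in> Cone" unfolding y0_def by (rule Cone_T) (use v0 in \<open>simp add: K_Cone\<close>)
    then have y0n: "y0 \<noteq> 0" by (simp add: Cone_def)
    have v: "v \<in> K" unfolding v_def by (rule Cone_sgn[OF y0])
    have vF: "span {v} \<in> furstenberg_dirs A \<C>"
      unfolding v_def span_sgn[OF y0n] unfolding y0_def by (rule furstenberg_T[OF v0(2)])
    have ny0: "c0 * a1 w \<le> norm y0" using c0(3)[of v0 w] v0 by (simp add: y0_def K_Cone)
    have ca: "0 < c0 * a1 w" using c0 a_pos[of w] by simp
    \<comment> \<open>Duality transfers \<open>y0\<close> to \<open>v0\<close>, and
      \<open>y0\<close> has length at least \<open>c0 * a1 w\<close>; so a short image forces a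
      small component along \<open>v\<close>.\<close>
    have strip: "\<bar>z \<bullet> v\<bar> \<le> norm (mat_word A w *v z) / (c0 * a1 w)" for z
    proof -
      have "z \<bullet> v = (z \<bullet> y0) / norm y0" by (simp add: v_def sgn_div_norm field_simps)
      also have "z \<bullet> y0 = (mat_word A w *v z) \<bullet> v0" by (simp add: y0_def inner_transpose)
      finally have "\<bar>z \<bullet> v\<bar> = \<bar>(mat_word A w *v z) \<bullet> v0\<bar> / norm y0" by simp
      also have "\<dots> \<le> norm (mat_word A w *v z) / norm y0"
        using Cauchy_Schwarz_ineq2[of "mat_word A w *v z" v0] v0 by (intro divide_right_mono) (auto simp: K_Cone)
      also have "\<dots> \<le> norm (mat_word A w *v z) / (c0 * a1 w)"
        using ny0 ca by (intro divide_left_mono) (auto intro: mult_pos_pos less_le_trans)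
      finally show ?thesis .
    qed
    have "0 < r / a1 w" using r a_pos[of w] by simp
    \<comment> \<open>Cylinders of this level are smaller than the strip, so replacing points by
      cylinders costs only a constant.\<close>
    then obtain n where n: "\<And>u. length u \<ge> n \<Longrightarrow> a1 u * d < r / a1 w" using a1_d_small by blast
    define J where "J = {u. length u = n \<and> cylinder (w @ u) \<inter> \<pi> -` ball x r \<noteq> {}}"
    have Jn: "J \<subseteq> {u. length u = n}" by (auto simp: J_def)
    have pt: "\<exists>y. y \<in> f u ` X \<and> f w y \<in> ball x r" if u: "u \<in> J" for u
    proof -
      obtain i where i: "i \<in> cylinder (w @ u)" "\<pi> i \<in> ball x r" using u by (auto simp: J_def)
      then show ?thesis using natural_proj_mem[OF i(1)] by (auto simp: aff_word_append)
    qed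
    \<comment> \<open>Of the 3, one unit allows for the size of a cylinder and two for the diameter
      of the disc; \<open>c0 \<le> 1\<close> gives them a common denominator.\<close>
    define R where "R = 3 * r / (c0 * a1 w)"
    have R: "0 < R" using r ca by (simp add: R_def)
    have cov: "cylinder w \<inter> \<pi> -` ball x r \<subseteq> (\<Union>u\<in>J. cylinder (w @ u))"
    proof
      fix i assume i: "i \<in> cylinder w \<inter> \<pi> -` ball x r"
      then obtain u where u: "length u = n" "i \<in> cylinder (w @ u)" using cylinder_append_ex by blast
      then have "u \<in> J" using i by (auto simp: J_def)
      then show "i \<in> (\<Union>u\<in>J. cylinder (w @ u))" using u by blast
    qed
    have "measure \<mu> (\<Union>u\<in>J. cylinder u) \<le> C * R"
    proof (cases "J = {}")
      case False
      \<comment> \<open>The strip bound is centred at points of X, so the centre is taken from the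
        preimage of the disc inside X.\<close>
      then obtain u0 y1 where y1: "u0 \<in> J" "y1 \<in> f u0 ` X" "f w y1 \<in> ball x r" using pt by blast
      have y1X: "y1 \<in> X" using y1 f_X by blast
      have "(\<Union>u\<in>J. cylinder u) \<subseteq> {i. \<bar>(\<pi> i - y1) \<bullet> v\<bar> < R}"
      proof
        fix i assume "i \<in> (\<Union>u\<in>J. cylinder u)"
        then obtain u where u: "u \<in> J" "i \<in> cylinder u" by auto
        obtain y where y: "y \<in> f u ` X" "f w y \<in> ball x r" using pt[OF u(1)] by blast
        have "dist (\<pi> i) y \<le> a1 u * d" by (rule dist_f_X[OF natural_proj_mem[OF u(2)] y(1)])
        also have "\<dots> < r / a1 w" using u by (intro n) (auto simp: J_def)
        finally have 1: "norm (\<pi> i - y) < r / a1 w" by (simp add: dist_norm)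
        have "norm (\<pi> i - y) * norm v < r / a1 w" using 1 v by (simp add: K_Cone)
        then have 2: "\<bar>(\<pi> i - y) \<bullet> v\<bar> < r / a1 w" using Cauchy_Schwarz_ineq2 le_less_trans by blast
        have "norm (mat_word A w *v (y - y1)) \<le> 2 * r"
          using y(2) y1(3) dist_triangle2[of "f w y" "f w y1" x]
          unfolding aff_word_diff[of A t w, symmetric] by (simp add: dist_norm norm_minus_commute)
        then have "norm (mat_word A w *v (y - y1)) / (c0 * a1 w) \<le> 2 * r / (c0 * a1 w)"
          using ca by (intro divide_right_mono) auto
        then have 3: "\<bar>(y - y1) \<bullet> v\<bar> \<le> 2 * r / (c0 * a1 w)" using strip[of "y - y1"] by linarith
        have "r / a1 w \<le> r / (c0 * a1 w)"
          using r ca c0 a_pos[of w] by (intro divide_left_mono) (auto simp: mult_left_le_one_le)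
        then have "\<bar>(\<pi> i - y) \<bullet> v\<bar> + \<bar>(y - y1) \<bullet> v\<bar> < R" using 2 3 by (simp add: R_def)
        moreover have "(\<pi> i - y1) \<bullet> v = (\<pi> i - y) \<bullet> v + (y - y1) \<bullet> v" by (simp add: inner_diff_left)
        ultimately show "i \<in> {i. \<bar>(\<pi> i - y1) \<bullet> v\<bar> < R}" by simp
      qed
      then have "measure \<mu> (\<Union>u\<in>J. cylinder u) \<le> measure \<mu> {i. \<bar>(\<pi> i - y1) \<bullet> v\<bar> < R}"
        by (intro finite_measure_mono measurable_strip)
      also have "\<dots> \<le> C * R" using L v vF y1X R unfolding lipschitz_projections_def by blast
      finally show ?thesis .
    qed (use C R in simp)
    then have J: "(\<Sum>u\<in>J. m u) \<le> C * R" by (simp add: sum_measure_cylinders[OF Jn])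
    have "measure \<mu> (cylinder w \<inter> \<pi> -` ball x r) \<le> measure \<mu> (\<Union>u\<in>J. cylinder (w @ u))"
      by (intro finite_measure_mono cov sets.finite_UN finite_subset[OF Jn finite_words]) auto
    also have "\<dots> = (\<Sum>u\<in>J. m (w @ u))" by (rule measure_cylinders[OF Jn])
    \<comment> \<open>Up to \<open>Q\<close>, the mass within \<open>cylinder w\<close> is a scaled
      copy of the whole measure, to which the strip bound applies.\<close>
    also have "\<dots> \<le> (\<Sum>u\<in>J. Q * m w * m u)" by (intro sum_mono Q)
    also have "\<dots> = Q * m w * (\<Sum>u\<in>J. m u)" by (simp add: sum_distrib_left)
    also have "\<dots> \<le> Q * (c\<^sub>K * \<phi> w) * (C * R)"
      using Q(1) c\<^sub>K phi_pos[of w] gibbs_phi(2)[of w] J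
      by (intro mult_mono) (auto intro: sum_nonneg simp: less_imp_le)
    also have "\<dots> = c * a2 w powr (s - 1) * r"
      using c0 a_pos(1)[of w] by (simp add: c_def R_def \<phi>_def field_simps)
    finally show ?thesis .
  qed
  show ?thesis by (rule that[of c]) (use bound Q c\<^sub>K C c0 in \<open>auto simp: c_def\<close>)
qed

text \<open>The first prefix at which \<open>a2\<close> times \<open>d\<close> drops to
  \<open>r\<close> is a stopping word; \<open>r < d\<close> prevents it from being empty.\<close>

lemma stopping_word_ex:
  assumes "0 < r" "r < d"
  shows "\<exists>n. word_prefix n x \<in> stopping_words A X r"
proof -
  define P where "P n \<longleftrightarrow> a2 (word_prefix n x) * d \<le> r" for n
  have "\<exists>n. P n"
  proof -
    obtain n where "\<And>w. length w \<ge> n \<Longrightarrow> a1 w * d < r" using a1_d_small[OF assms(1)] by blast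
    then have "a1 (word_prefix n x) * d < r" by simp
    moreover have "a2 (word_prefix n x) * d \<le> a1 (word_prefix n x) * d"
      using d_nonneg by (intro mult_right_mono alpha_nonneg)
    ultimately have "P n" by (simp add: P_def)
    then show ?thesis by blast
  qed
  moreover have "\<not> P 0" using assms by (simp add: P_def word_prefix_def alpha_one)
  ultimately obtain k where "\<not> P k" "P (Suc k)" using ex_least_nat_less[of P] by blast
  then have "word_prefix (Suc k) x \<in> stopping_words A X r"
    by (auto simp: stopping_words_def P_def word_prefix_Suc d_def)
  then show ?thesis by blast
qed

text \<open>Stopping words cut every sequence, and the neighbourhood condition bounds how many of
  their cylinders can reach the disc. Each contributes at most a constant times
  \<open>r powr s\<close>.\<close>

lemma ball_measure:
  assumes L: "lipschitz_projections C" and C: "0 < C" and obnc: "obnc A t X" and d: "0 < d"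
  obtains c where "0 < c" "\<And>x r. 0 < r \<Longrightarrow> measure \<mu> (\<pi> -` ball x r) \<le> c * r powr s"
proof -
  obtain c1 where c1: "0 < c1"
    "\<And>w x r. 0 < r \<Longrightarrow> measure \<mu> (cylinder w \<inter> \<pi> -` ball x r) \<le> c1 * a2 w powr (s - 1) * r"
    using cylinder_ball_measure[OF L C] by blast
  obtain U N where U: "U \<noteq> {}" "\<forall>i. aff A t i ` U \<subseteq> U" and N: "0 < (N :: real)"
    and fin: "\<forall>r>0. \<forall>x. finite {w \<in> stopping_words A X r. f w ` U \<inter> ball x r \<noteq> {}} \<and>
       real (card {w \<in> stopping_words A X r. f w ` U \<inter> ball x r \<noteq> {}}) \<le> N"
    using obnc unfolding obnc_def by blast
  have fU: "f w ` U \<subseteq> U" for w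
  proof (induction w)
    case (Cons i w)
    then show ?case using U(2) by (auto simp: image_subset_iff)
  qed auto
  \<comment> \<open>The point \<open>\<pi> i\<close> need not lie in the image of U, but it is a
    limit of points of that image and the disc is open.\<close>
  have meet: "f (word_prefix k i) ` U \<inter> ball x r \<noteq> {}" if "\<pi> i \<in> ball x r" for i x r k
  proof -
    obtain a where a: "a \<in> U" using U by auto
    have "\<forall>\<^sub>F n in sequentially. f (word_prefix n i) a \<in> ball x r"
      using f_tendsto[of i a] that by (rule topological_tendstoD[OF _ open_ball])
    then have "\<forall>\<^sub>F n in sequentially. n \<ge> k \<and> f (word_prefix n i) a \<in> ball x r"
      using eventually_ge_at_top[of k] by eventually_elim auto
    then obtain n where n: "n \<ge> k" "f (word_prefix n i) a \<in> ball x r"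
      using eventually_happens'[OF sequentially_bot] by blast
    have "word_prefix n i = word_prefix k i @ map i [k..<n]"
      using n(1) unfolding word_prefix_def by (metis le_add_diff_inverse map_append upt_add_eq_append zero_le)
    then have "f (word_prefix n i) a = f (word_prefix k i) (f (map i [k..<n]) a)"
      by (simp add: aff_word_append)
    moreover have "f (map i [k..<n]) a \<in> U" using fU a by blast
    ultimately show ?thesis using n(2) by auto
  qed
  \<comment> \<open>The first term serves radii of at least \<open>d\<close>, where total mass 1
    suffices; the second sums over at most \<open>N\<close> stopping words.\<close>
  define c where "c = max (d powr (- s)) (N * c1 * d powr (1 - s))"
  have "measure \<mu> (\<pi> -` ball x r) \<le> c * r powr s" if r: "0 < r" for x r
  proof (cases "r < d")
    case False
    have "measure \<mu> (\<pi> -` ball x r) \<le> d powr (- s) * d powr s"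
      using d by (simp flip: powr_add)
    also have "\<dots> \<le> c * r powr s"
      using False d s by (intro mult_mono powr_mono2) (auto simp: c_def le_max_iff_disj)
    finally show ?thesis .
  next
    case True
    define W where "W = {w \<in> stopping_words A X r. f w ` U \<inter> ball x r \<noteq> {}}"
    have W: "finite W" "real (card W) \<le> N" using fin r by (auto simp: W_def)
    have ms: "cylinder w \<inter> \<pi> -` ball x r \<in> sets \<mu>" for w
      using measurable_sets[OF natural_proj_measurable, of "ball x r"] by (auto simp: space_\<mu>)
    have "\<pi> -` ball x r \<subseteq> (\<Union>w\<in>W. cylinder w \<inter> \<pi> -` ball x r)"
    proof
      fix i assume i: "i \<in> \<pi> -` ball x r"
      obtain n where n: "word_prefix n i \<in> stopping_words A X r" using stopping_word_ex[OF r True] by blast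
      have "word_prefix n i \<in> W" using n meet i by (auto simp: W_def)
      then show "i \<in> (\<Union>w\<in>W. cylinder w \<inter> \<pi> -` ball x r)" using i mem_cylinder_prefix by blast
    qed
    then have "measure \<mu> (\<pi> -` ball x r) \<le> measure \<mu> (\<Union>w\<in>W. cylinder w \<inter> \<pi> -` ball x r)"
      using W ms by (intro finite_measure_mono sets.finite_UN)
    also have "\<dots> \<le> (\<Sum>w\<in>W. measure \<mu> (cylinder w \<inter> \<pi> -` ball x r))"
      using W ms by (intro finite_measure_subadditive_finite) auto
    also have "\<dots> \<le> (\<Sum>w\<in>W. c1 * (r / d) powr (s - 1) * r)"
    proof (rule sum_mono)
      fix w assume "w \<in> W"
      then have "a2 w * d \<le> r" by (simp add: W_def stopping_words_def d_def)
      then have "a2 w \<le> r / d" using d by (simp add: field_simps)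
      then have "c1 * a2 w powr (s - 1) * r \<le> c1 * (r / d) powr (s - 1) * r"
        using c1(1) r s a_pos(2)[of w] by (intro mult_right_mono mult_left_mono powr_mono2) auto
      then show "measure \<mu> (cylinder w \<inter> \<pi> -` ball x r) \<le> c1 * (r / d) powr (s - 1) * r"
        using c1(2)[OF r, of w x] by linarith
    qed
    also have "\<dots> = real (card W) * (c1 * (r / d) powr (s - 1) * r)" by simp
    also have "\<dots> \<le> N * (c1 * (r / d) powr (s - 1) * r)"
      using W(2) c1(1) r by (intro mult_right_mono) auto
    also have "\<dots> = N * c1 * d powr (1 - s) * r powr s"
    proof -
      have "(r / d) powr (s - 1) * r = d powr (1 - s) * r powr s"
        using r d by (simp add: powr_divide powr_diff field_simps)
      then show ?thesis by simp
    qed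
    also have "\<dots> \<le> c * r powr s" by (intro mult_right_mono) (auto simp: c_def)
    finally show ?thesis .
  qed
  moreover have "0 < c" using d by (simp add: c_def less_max_iff_disj)
  ultimately show ?thesis using that by blast
qed

lemma lipschitz_imp_hausdorff_pos:
  assumes L: "lipschitz_projections C" and C: "0 < C" and obnc: "obnc A t X"
  shows "0 < hausdorff s X"
proof -
  have d: "0 < d" using no_lipschitz_singleton[OF _ C] L d_nonneg by fastforce
  obtain c where c: "0 < c" "\<And>x r. 0 < r \<Longrightarrow> measure \<mu> (\<pi> -` ball x r) \<le> c * r powr s"
    using ball_measure[OF L C obnc d] by blast
  show ?thesis
    by (rule mass_distribution_principle[OF prob natural_proj_measurable _ _ c(1)])
       (use c(2) s natural_proj_X in \<open>auto simp: space_\<mu>\<close>)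
qed

section \<open>From positive Hausdorff measure to bounded projections\<close>

lemma fincover_word:
  assumes "G \<subseteq> cball x \<rho>" "0 < \<rho>"
  shows "fincover s (f u ` G) (27 * c\<^sub>K * \<rho> powr s * m u)"
proof -
  have "fincover s (f u ` G) (27 * \<phi> u * \<rho> powr s)"
    unfolding \<phi>_def by (rule fincover_affine_image[OF aff_word_diff det_word assms s])
  moreover have "27 * \<phi> u * \<rho> powr s \<le> 27 * (c\<^sub>K * m u) * \<rho> powr s"
    by (intro mult_right_mono mult_left_mono gibbs_phi) auto
  ultimately show ?thesis by (auto elim: fincover_mono simp: mult_ac)
qed

text \<open>A strip of width \<open>r\<close> orthogonal to a Furstenberg direction that carries mass more than \<open>M r\<close>
  is mapped by a suitable \<open>f w\<close> into a disc of radius comparable to \<open>a2 w\<close> and of mass at least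
  a constant times \<open>M * a2 w powr s\<close>. The same then holds, at the cost of covering an ellipse,
  inside every cylinder.\<close>

lemma heavy_words:
  assumes dom: "dominated A"
  obtains c where "0 < c"
    "\<And>M. 1 \<le> M \<Longrightarrow> \<not> lipschitz_projections M \<Longrightarrow>
       \<exists>L B \<beta>. B \<subseteq> {v. length v = L} \<and> 0 < \<beta> \<and>
         (\<forall>u. \<beta> * m u \<le> (\<Sum>v\<in>B. m (u @ v)) \<and>
              fincover s (\<Union>v\<in>B. f (u @ v) ` X) (c / M * \<beta> * m u))"
proof -
  obtain Q where Q: "0 < Q" "\<And>u v. m u * m v \<le> Q * m (u @ v)"
    using quasi_bernoulli by blast
  obtain c0 where c0: "0 < c0" "c0 \<le> 1" "\<And>w v. v \<in> Cone \<Longrightarrow> c0 * a1 w * norm v \<le> norm (T w *v v)"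
    using cone_expansion by blast
  obtain Cd \<tau> where D: "0 < Cd" "0 < \<tau>" "\<tau> < 1" "\<And>w. a2 w \<le> Cd * \<tau> ^ length w * a1 w"
    using dom unfolding dominated_def by blast
  \<comment> \<open>The width \<open>4 * r\<close> across the strip contributes
    \<open>8 / \<kappa>\<close>, and the extent \<open>d\<close> of X contributes
    \<open>d / c0\<close>.\<close>
  define K0 where "K0 = 8 / \<kappa> + d / c0"
  have K0: "0 < K0" unfolding K0_def using kappa_pos d_nonneg c0 by (intro add_pos_nonneg) auto
  define c where "c = 27 * c\<^sub>K\<^sup>2 * K0 powr s * Q\<^sup>2"
  have "0 < c" using c\<^sub>K K0 Q by (simp add: c_def)
  then show ?thesis
  proof (rule that)
    fix M :: real assume M: "1 \<le> M" "\<not> lipschitz_projections M"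
    obtain v p r where v: "v \<in> K" "span {v} \<in> furstenberg_dirs A \<C>" and p: "p \<in> X" and r: "0 < r"
      and heavy: "M * r < measure \<mu> {x. \<bar>(\<pi> x - p) \<bullet> v\<bar> < r}"
      using M(2) unfolding lipschitz_projections_def by (auto simp: not_le)
    define S where "S = {x. \<bar>(\<pi> x - p) \<bullet> v\<bar> < r}"
    have vn: "norm v = 1" using v by (simp add: K_Cone)
    \<comment> \<open>Total mass 1 forces a heavy strip to be thinner than 1, as the stopping
      argument requires.\<close>
    have "M * r < 1" using heavy prob_le_1 less_le_trans by blast
    moreover have "1 * r \<le> M * r" using M(1) r by (intro mult_right_mono) auto
    ultimately have r1: "r < 1" by linarith
    \<comment> \<open>Domination then gives \<open>a2 \<le> r * a1\<close> for all words of length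
      \<open>n0\<close>, in particular for one representing the direction of
      \<open>v\<close>.\<close>
    obtain n0 where n0: "\<tau> ^ n0 < r / Cd" using real_arch_pow_inv[of "r / Cd" \<tau>] r D by auto
    obtain w' v0 where w': "length w' = n0" "v0 \<in> Cone" "span {v} = span {T w' *v v0}"
      using v(2) unfolding mem_furstenberg by blast
    have "a2 w' \<le> (Cd * \<tau> ^ n0) * a1 w'" using D(4)[of w'] w'(1) by simp
    also have "\<dots> \<le> r * a1 w'"
      using n0 D(1) a_pos(1)[of w'] by (intro mult_right_mono) (auto simp: field_simps)
    finally obtain u0 w where w: "w' = u0 @ w" "a2 w \<le> r * a1 w" "\<kappa> * (r * a1 w) \<le> a2 w"
      using stopping_suffix[OF r1 r] by blast
    \<comment> \<open>The discarded prefix is absorbed into a new unit vector of the cone, so the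
      suffix \<open>w\<close> still sends a cone vector to the direction of
      \<open>v\<close>.\<close>
    define z0 where "z0 = sgn (T u0 *v v0)"
    have Tu0: "T u0 *v v0 \<in> Cone" by (rule Cone_T[OF w'(2)])
    have z0: "z0 \<in> K" unfolding z0_def by (rule Cone_sgn[OF Tu0])
    have "T w' *v v0 = T w *v (T u0 *v v0)"
      by (simp add: w(1) mat_word_append matrix_transpose_mul matrix_vector_mul_assoc)
    then have "span {v} = span {T w *v z0}"
      using w'(3) Tu0 by (simp add: z0_def span_sgn Cone_def flip: rp1_act_span)
    then obtain \<gamma> where \<gamma>: "T w *v z0 = \<gamma> *\<^sub>R v" "\<bar>\<gamma>\<bar> = norm (T w *v z0)"
      using unit_span_mult[OF vn] by metis
    have \<gamma>_ge: "c0 * a1 w \<le> \<bar>\<gamma>\<bar>" using c0(3)[of z0 w] z0 \<gamma>(2) by (simp add: K_Cone)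
    have ca: "0 < c0 * a1 w" using c0 a_pos[of w] by simp
    have shrink: "norm (mat_word A w *v z) \<le> K0 * a2 w" if z: "\<bar>z \<bullet> v\<bar> \<le> 4 * r" "norm z \<le> d" for z
    proof -
      have "\<bar>det (mat_word A w)\<bar> / \<bar>\<gamma>\<bar> \<le> \<bar>det (mat_word A w)\<bar> / (c0 * a1 w)"
        using \<gamma>_ge ca by (intro divide_left_mono) auto
      also have "\<dots> = a2 w / c0" using a2_eq[of w] a_pos(1)[of w] c0(1) by (simp add: field_simps)
      finally have det: "\<bar>det (mat_word A w)\<bar> / \<bar>\<gamma>\<bar> \<le> a2 w / c0" .
      have "norm (mat_word A w *v z) \<le> 2 * a1 w * \<bar>z \<bullet> v\<bar> + \<bar>det (mat_word A w)\<bar> / \<bar>\<gamma>\<bar> * norm z"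
        using z0 \<gamma>_ge ca by (intro norm_mult_strip[OF _ vn \<gamma>(1)]) (auto simp: K_Cone)
      also have "\<dots> \<le> 2 * a1 w * (4 * r) + a2 w / c0 * d"
        using z det a_pos[of w] c0(1) by (intro add_mono mult_mono mult_left_mono) auto
      also have "\<dots> \<le> 8 * (a2 w / \<kappa>) + a2 w / c0 * d"
        using w(3) kappa_pos by (simp add: field_simps)
      also have "\<dots> = K0 * a2 w" by (simp add: K0_def field_simps)
      finally show ?thesis .
    qed
    obtain n where n: "\<And>u. length u \<ge> n \<Longrightarrow> a1 u * d < r" using a1_d_small[OF r] by blast
    define J where "J = {u. length u = n \<and> cylinder u \<inter> S \<noteq> {}}"
    have Jn: "J \<subseteq> {u. length u = n}" by (auto simp: J_def)
    have "S \<subseteq> (\<Union>u\<in>J. cylinder u)"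
    proof
      fix x assume "x \<in> S"
      then have "word_prefix n x \<in> J" using mem_cylinder_prefix[of x n] by (auto simp: J_def)
      then show "x \<in> (\<Union>u\<in>J. cylinder u)" using mem_cylinder_prefix[of x n] by blast
    qed
    then have "measure \<mu> S \<le> measure \<mu> (\<Union>u\<in>J. cylinder u)"
      by (intro finite_measure_mono sets.finite_UN finite_subset[OF Jn finite_words]) auto
    with heavy have mJ: "M * r < (\<Sum>u\<in>J. m u)"
      unfolding S_def sum_measure_cylinders[OF Jn] by linarith
    \<comment> \<open>The heavy strip is replaced by a union of cylinder images, which lies in a
      strip of twice the width and carries no less mass.\<close>
    define E where "E = (\<Union>u\<in>J. f u ` X)"
    have EX: "E \<subseteq> X" unfolding E_def using f_X by blast
    have E_strip: "\<bar>(a - p) \<bullet> v\<bar> < 2 * r" if a: "a \<in> E" for a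
    proof -
      obtain u x where u: "u \<in> J" "a \<in> f u ` X" "x \<in> cylinder u" "x \<in> S"
        using a by (auto simp: E_def J_def)
      have "dist a (\<pi> x) \<le> a1 u * d" by (rule dist_f_X[OF u(2) natural_proj_mem[OF u(3)]])
      also have "\<dots> < r" using u(1) by (intro n) (auto simp: J_def)
      finally have "norm (a - \<pi> x) * norm v < r" using vn by (simp add: dist_norm)
      then have "\<bar>(a - \<pi> x) \<bullet> v\<bar> < r" using Cauchy_Schwarz_ineq2 le_less_trans by blast
      moreover have "\<bar>(\<pi> x - p) \<bullet> v\<bar> < r" using u(4) by (simp add: S_def)
      moreover have "(a - p) \<bullet> v = (a - \<pi> x) \<bullet> v + (\<pi> x - p) \<bullet> v" by (simp add: inner_diff_left)
      ultimately show ?thesis by linarith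
    qed
    have "J \<noteq> {}" using mJ M(1) r by (auto simp: mult_less_0_iff)
    then obtain a0 where a0: "a0 \<in> E" using X_nonempty by (auto simp: E_def)
    have E_ball: "f w ` E \<subseteq> cball (f w a0) (K0 * a2 w)"
    proof (intro subsetI, elim imageE)
      fix y a assume a: "y = f w a" "a \<in> E"
      have "(a0 - a) \<bullet> v = (a0 - p) \<bullet> v - (a - p) \<bullet> v" by (simp add: inner_diff_left)
      then have "\<bar>(a0 - a) \<bullet> v\<bar> \<le> 4 * r" using E_strip[OF a0] E_strip[OF a(2)] by linarith
      moreover have "norm (a0 - a) \<le> d" using dist_X[of a0 a] a0 a(2) EX by (auto simp: dist_norm)
      ultimately show "y \<in> cball (f w a0) (K0 * a2 w)"
        using shrink[of "a0 - a"] by (simp add: a(1) dist_norm aff_word_diff)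
    qed
    define B where "B = (@) w ` J"
    \<comment> \<open>The proportion of each cylinder occupied by copies of the strip:
      \<open>Q\<close> enters twice because words are split into three factors, and
      \<open>c\<^sub>K\<close> converts \<open>\<phi> w\<close> into \<open>m w\<close>.\<close>
    define \<beta> where "\<beta> = M * a2 w powr s / (Q\<^sup>2 * c\<^sub>K)"
    have \<beta>: "0 < \<beta>" using M(1) a_pos(2)[of w] Q(1) c\<^sub>K by (simp add: \<beta>_def)
    have BL: "B \<subseteq> {v. length v = length w + n}" by (auto simp: B_def J_def)
    have cover: "fincover s (\<Union>v\<in>B. f (u @ v) ` X) (c / M * \<beta> * m u)" for u
    proof -
      have "(\<Union>v\<in>B. f (u @ v) ` X) = f u ` (f w ` E)"
        by (auto simp: B_def E_def aff_word_append image_iff)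
      moreover have "fincover s (f u ` (f w ` E)) (27 * c\<^sub>K * (K0 * a2 w) powr s * m u)"
        by (rule fincover_word[OF E_ball]) (use K0 a_pos in simp)
      \<comment> \<open>The cost carries no factor \<open>M\<close> whereas \<beta> does; this is
        the source of the gain 1 / \<open>M\<close>.\<close>
      moreover have "27 * c\<^sub>K * (K0 * a2 w) powr s * m u = c / M * \<beta> * m u"
        using M(1) K0 a_pos(2)[of w] Q(1) c\<^sub>K
        by (simp add: c_def \<beta>_def powr_mult power2_eq_square field_simps)
      ultimately show ?thesis by simp
    qed
    have mass: "\<beta> * m u \<le> (\<Sum>v\<in>B. m (u @ v))" for u
    proof -
      have pw: "a2 w powr s \<le> \<phi> w * r"
      proof -
        have "a2 w powr s = a2 w * a2 w powr (s - 1)"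
          using a_pos(2)[of w] by (simp add: powr_diff)
        also have "\<dots> \<le> r * a1 w * a2 w powr (s - 1)" by (intro mult_right_mono w) auto
        finally show ?thesis by (simp add: \<phi>_def mult_ac)
      qed
      have "M * a2 w powr s * m u \<le> M * (\<phi> w * r) * m u"
        using M(1) by (intro mult_right_mono mult_left_mono pw) auto
      also have "\<dots> \<le> M * ((c\<^sub>K * m w) * r) * m u"
        using M(1) r by (intro mult_right_mono mult_left_mono gibbs_phi) auto
      also have "\<dots> = c\<^sub>K * m u * (m w * (M * r))" by simp
      also have "\<dots> \<le> c\<^sub>K * m u * (m w * (\<Sum>j\<in>J. m j))"
        using mJ c\<^sub>K by (intro mult_left_mono) auto
      also have "\<dots> = c\<^sub>K * m u * (\<Sum>j\<in>J. m w * m j)" by (simp add: sum_distrib_left)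
      also have "\<dots> \<le> c\<^sub>K * m u * (\<Sum>j\<in>J. Q * m (w @ j))"
        using c\<^sub>K by (intro mult_left_mono sum_mono Q) auto
      also have "\<dots> = c\<^sub>K * Q * (\<Sum>j\<in>J. m u * m (w @ j))" by (simp add: sum_distrib_left mult_ac)
      also have "\<dots> \<le> c\<^sub>K * Q * (\<Sum>j\<in>J. Q * m (u @ w @ j))"
        using c\<^sub>K Q(1) by (intro mult_left_mono sum_mono Q) auto
      also have "\<dots> = Q\<^sup>2 * c\<^sub>K * (\<Sum>j\<in>J. m (u @ w @ j))"
        by (simp add: sum_distrib_left power2_eq_square mult_ac)
      also have "(\<Sum>j\<in>J. m (u @ w @ j)) = (\<Sum>v\<in>B. m (u @ v))"
        unfolding B_def by (subst sum.reindex) (auto simp: inj_on_def)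
      finally show ?thesis using Q(1) c\<^sub>K by (simp add: \<beta>_def field_simps)
    qed
    show "\<exists>L B \<beta>. B \<subseteq> {v. length v = L} \<and> 0 < \<beta> \<and>
         (\<forall>u. \<beta> * m u \<le> (\<Sum>v\<in>B. m (u @ v)) \<and>
              fincover s (\<Union>v\<in>B. f (u @ v) ` X) (c / M * \<beta> * m u))"
      using BL \<beta> mass cover by blast
  qed
qed

text \<open>Each round covers the heavy part of every remaining cylinder at cost \<open>a\<close> per unit of mass and
  leaves at most the proportion \<open>1 - \<beta>\<close> of the mass uncovered.\<close>

lemma fincover_iterate:
  assumes B: "B \<subseteq> {v. length v = L}" and \<beta>: "0 < \<beta>" "\<beta> \<le> 1" and a: "0 \<le> a" and b: "0 \<le> b"
    and mass: "\<And>u. \<beta> * m u \<le> (\<Sum>v\<in>B. m (u @ v))"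
    and heavy: "\<And>u. fincover s (\<Union>v\<in>B. f (u @ v) ` X) (a * \<beta> * m u)"
    and start: "\<And>u. fincover s (f u ` X) (b * m u)"
  shows "fincover s (f u ` X) ((a + b * (1 - \<beta>) ^ k) * m u)"
proof (induction k arbitrary: u)
  case 0
  show ?case using a by (auto intro!: fincover_mono[OF start[of u] order_refl] mult_right_mono)
next
  case (Suc k)
  define R where "R = {v. length v = L} - B"
  \<comment> \<open>The cost per unit of mass after k rounds, applied to each remaining
    cylinder.\<close>
  define q where "q = a + b * (1 - \<beta>) ^ k"
  have q: "0 \<le> q" using a b \<beta> by (simp add: q_def)
  have fR: "finite R" unfolding R_def using finite_words by blast
  have "f u ` X = f u ` (\<Union>v\<in>{v. length v = L}. f v ` X)" using X_eq_words[of L] by simp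
  also have "\<dots> = (\<Union>v\<in>{v. length v = L}. f (u @ v) ` X)" by (auto simp: aff_word_append image_iff)
  also have "\<dots> = (\<Union>v\<in>B. f (u @ v) ` X) \<union> (\<Union>v\<in>R. f (u @ v) ` X)" using B by (auto simp: R_def)
  finally have eq: "f u ` X = (\<Union>v\<in>B. f (u @ v) ` X) \<union> (\<Union>v\<in>R. f (u @ v) ` X)" .
  have "fincover s (\<Union>v\<in>R. f (u @ v) ` X) (\<Sum>v\<in>R. q * m (u @ v))"
    by (rule fincover_UN[OF fR]) (simp only: q_def Suc.IH)
  then have 1: "fincover s (f u ` X) (a * \<beta> * m u + (\<Sum>v\<in>R. q * m (u @ v)))"
    unfolding eq by (rule fincover_Un[OF heavy])
  have "(\<Sum>v\<in>R. m (u @ v)) = m u - (\<Sum>v\<in>B. m (u @ v))"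
    unfolding R_def using B finite_words by (subst sum_diff) (auto simp: measure_cylinders_all)
  also have "\<dots> \<le> (1 - \<beta>) * m u" using mass[of u] by (simp add: algebra_simps)
  finally have "q * (\<Sum>v\<in>R. m (u @ v)) \<le> q * ((1 - \<beta>) * m u)" by (rule mult_left_mono[OF _ q])
  then have "a * \<beta> * m u + (\<Sum>v\<in>R. q * m (u @ v)) \<le> a * \<beta> * m u + q * ((1 - \<beta>) * m u)"
    by (simp add: sum_distrib_left)
  also have "\<dots> = (a + b * (1 - \<beta>) ^ Suc k) * m u" by (simp add: q_def algebra_simps)
  finally show ?case by (rule fincover_mono[OF 1 order_refl])
qed

lemma hausdorff_pos_imp_lipschitz:
  assumes dom: "dominated A" and pos: "0 < hausdorff s X"
  shows "\<exists>C>0. lipschitz_projections C"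
proof (rule ccontr)
  assume "\<not> (\<exists>C>0. lipschitz_projections C)"
  then have no: "\<not> lipschitz_projections C" if "1 \<le> C" for C using that by auto
  obtain c where c: "0 < c" "\<And>M. 1 \<le> M \<Longrightarrow> \<not> lipschitz_projections M \<Longrightarrow>
       \<exists>L B \<beta>. B \<subseteq> {v. length v = L} \<and> 0 < \<beta> \<and>
         (\<forall>u. \<beta> * m u \<le> (\<Sum>v\<in>B. m (u @ v)) \<and>
              fincover s (\<Union>v\<in>B. f (u @ v) ` X) (c / M * \<beta> * m u))"
    using heavy_words[OF dom] by blast
  obtain x where x: "x \<in> X" using X_nonempty by auto
  \<comment> \<open>The price of a crude initial cover of each cylinder image; \<open>d + 1\<close>
    ensures a positive radius.\<close>
  define b where "b = 27 * c\<^sub>K * (d + 1) powr s"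
  have b: "0 \<le> b" using c\<^sub>K by (simp add: b_def)
  have start: "fincover s (f u ` X) (b * m u)" for u
    unfolding b_def using dist_X[OF x] d_nonneg by (intro fincover_word[of X x]) force+
  have "fincover s X e" if e: "0 < e" for e
  proof -
    \<comment> \<open>Half of \<open>e\<close> is reserved for the heavy parts, the other half for
      what remains after \<open>k\<close> rounds.\<close>
    define M where "M = max 1 (2 * c / e)"
    have M: "1 \<le> M" "2 * c / e \<le> M" by (auto simp: M_def)
    obtain L B \<beta> where B: "B \<subseteq> {v. length v = L}" "0 < \<beta>"
      and mass: "\<And>u. \<beta> * m u \<le> (\<Sum>v\<in>B. m (u @ v))"
      and heavy: "\<And>u. fincover s (\<Union>v\<in>B. f (u @ v) ` X) (c / M * \<beta> * m u)"
      using c(2)[OF M(1) no[OF M(1)]] by blast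
    \<comment> \<open>The heavy words are among all words of one length, so their proportion \<beta>
      cannot exceed 1.\<close>
    have "(\<Sum>v\<in>B. m ([] @ v)) \<le> m []"
      unfolding measure_cylinders_all[of "[]" L, symmetric]
      by (rule sum_mono2) (use B finite_words in auto)
    then have "\<beta> * m [] \<le> 1 * m []" using mass[of "[]"] by linarith
    then have \<beta>: "\<beta> \<le> 1" using m_pos[of "[]"] by (simp only: mult_le_cancel_right_pos)
    have aM: "c / M \<le> e / 2" using M e c(1) by (simp add: field_simps)
    obtain k where k: "(1 - \<beta>) ^ k < e / 2 / (b + 1)"
      using real_arch_pow_inv[of "e / 2 / (b + 1)" "1 - \<beta>"] e b B(2) by auto
    have "(1 - \<beta>) ^ k * (b + 1) < e / 2"
      by (rule iffD1[OF pos_less_divide_eq k]) (use b in simp)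
    moreover have "0 \<le> (1 - \<beta>) ^ k" using \<beta> by simp
    ultimately have k': "b * (1 - \<beta>) ^ k \<le> e / 2" by (simp add: algebra_simps)
    have "fincover s (f [] ` X) ((c / M + b * (1 - \<beta>) ^ k) * m [])"
      by (rule fincover_iterate[OF B \<beta> _ b mass heavy start]) (use c(1) M in auto)
    moreover have "(c / M + b * (1 - \<beta>) ^ k) * m [] \<le> e * 1"
    proof (rule mult_mono)
      show "c / M + b * (1 - \<beta>) ^ k \<le> e" using aM k' by linarith
    qed (use e in auto)
    ultimately show ?thesis by (auto elim: fincover_mono)
  qed
  then have "hausdorff s X = 0" using s by (intro hausdorff_eq_0) auto
  then show False using pos by simp
qed

end

theorem theorem1p3:
  fixes A :: "'a::finite \<Rightarrow> real^2^2"
    and t :: "'a \<Rightarrow> real^2"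
    and X :: "(real^2) set"
    and \<C> :: "(real^2) set set"
    and \<mu> :: "(nat \<Rightarrow> 'a) measure"
  assumes "affine_ifs A t"
    and "dominated A"
    and "1 < affinity_dim A" and "affinity_dim A \<le> 2"
    and "is_attractor A t X"
    and "strongly_invariant_multicone A \<C>"
    and "kaenmaki_measure A \<mu>"
    and "obnc A t X"
  shows "hausdorff (affinity_dim A) X > 0 \<longleftrightarrow>
    (\<exists>C::real. C > 0 \<and>
      (\<forall>V \<in> furstenberg_dirs A \<C>. \<forall>p \<in> orth_proj V ` X. \<forall>r>0.
         measure (proj_measure A t \<mu> V) (V \<inter> ball p r) \<le> C * r))"
proof -
  obtain c where c: "0 < c"
    "\<And>w. inverse c * sv_fun (affinity_dim A) (mat_word A w) \<le> measure \<mu> (cylinder w)"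
    "\<And>w. measure \<mu> (cylinder w) \<le> c * sv_fun (affinity_dim A) (mat_word A w)"
    and \<mu>: "sets \<mu> = sets word_borel" "prob_space \<mu>"
    using assms(7) unfolding kaenmaki_measure_def by blast
  interpret kaenmaki_system A t \<C> X \<mu> "affinity_dim A" c
    by (intro kaenmaki_system.intro multicone.intro kaenmaki_system_axioms.intro) (rule assms c \<mu>)+
  show ?thesis
    unfolding lipschitz_projections_iff[symmetric]
    using lipschitz_imp_hausdorff_pos hausdorff_pos_imp_lipschitz assms by blast
qed

end
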